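(* Let $d=2$ and let $Q$ be a probability measure on $\Omega=\{0,1\}^{\mathbb{Z}^2}$ such that (1) $Q$ is stationary and ergodic with respect to each of the shifts $\theta_{e_1},\theta_{e_2}$, and (2) $Q(\mathcal{P}(\omega)=\emptyset)<1$. Assume there exists a constant $C>0$ such that $$\sum_{k=N}^{\infty}k\cdot P(f_{e_i}=k)\le\frac{C}{N}\qquad\text{for all } i\in\{1,2\}\text{ and all integers }N\ge 1,$$ which in particular holds whenever $f_{e_i}$ has a finite second moment under $P$ for $i\in\{1,2\}$. Then the random walk $(X_n)_{n\ge0}$ on the discrete point process is $\mathbb{P}$-almost surely recurrent, where $\mathbb{P}$ is the annealed law.
   Context: Setting (with $d=2$). $\Omega=\{0,1\}^{\mathbb{Z}^2}$ carries its product Borel $\sigma$-algebra. For $x\in\mathbb{Z}^2$, $(\theta_x\omega)(y)=\omega(x+y)$. $e_1,e_2$ are the standard unit vectors and $\mathcal{E}=\{\pm e_1,\pm e_2\}$. $\mathcal{P}(\omega)=\{x\in\mathbb{Z}^2:\omega(x)=1\}$. $\Omega_0=\{\omega:\omega(0)=1\}$; under (1),(2) one has $Q(\Omega_0)>0$, and $P(\cdot)=Q(\cdot\mid\Omega_0)$. For $e\in\mathcal{E}$, $f_e(\omega)=\min\{k>0:\omega(ke)=1\}$ (for $Q$-a.e. $\omega$, $f_e(\theta_v\omega)<\infty$ for all $v,e$). The coordinate nearest neighbors of $v$ are $N_v(\omega)=\{v+f_e(\theta_v\omega)e:e\in\mathcal{E}\}$. For $P$-a.e. $\omega\in\Omega_0$,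 $P_\omega$ (quenched law) is the law of the Markov chain $(X_n)_{n\ge0}$ on $\mathcal{P}(\omega)$ with $P_\omega(X_0=0)=1$ and $P_\omega(X_{n+1}=u\mid X_n=v)=\frac14$ if $u\in N_v(\omega)$ and $0$ otherwise. The annealed law is $\mathbb{P}(G)=\int P_\omega(G)\,P(d\omega)$. Recurrent means that $X_n=0$ for infinitely many $n$. *)

theory Defs
  imports "HOL-Probability.Probability"
begin

text \<open>The alphabet \<open>{0,1}\<close> is rendered as \<^typ>\<open>bool\<close>, with 1 as \<^term>\<open>True\<close>.\<close>

type_synonym site = "int \<times> int"
type_synonym env = "site \<Rightarrow> bool"

definition env_space :: "env measure" where
  "env_space = (\<Pi>\<^sub>M x\<in>UNIV. count_space UNIV)"

definition env_shift :: "site \<Rightarrow> env \<Rightarrow> env" where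
  "env_shift x \<omega> = (\<lambda>y. \<omega> (x + y))"

definition e1 :: site where "e1 = (1, 0)"
definition e2 :: site where "e2 = (0, 1)"

definition directions :: "site set" where
  "directions = {e1, - e1, e2, - e2}"

definition smult_site :: "nat \<Rightarrow> site \<Rightarrow> site" (infixr "\<cdot>\<^sub>s" 75) where
  "k \<cdot>\<^sub>s e = (int k * fst e, int k * snd e)"

definition points :: "env \<Rightarrow> site set" where
  "points \<omega> = {x. \<omega> x}"

text \<open>The infimum in \<^typ>\<open>enat\<close> is the minimum if there is a point of the process on the open
  half-line in direction \<open>e\<close>, and \<open>\<infinity>\<close> otherwise.\<close>

definition next_dist :: "site \<Rightarrow> env \<Rightarrow> enat" where
  "next_dist e \<omega> = (INF k\<in>{k. 0 < k \<and> \<omega> (k \<cdot>\<^sub>s e)}. enat k)"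

definition neighbors :: "env \<Rightarrow> site \<Rightarrow> site set" where
  "neighbors \<omega> v = {v + k \<cdot>\<^sub>s e | e k. e \<in> directions \<and> next_dist e (env_shift v \<omega>) = enat k}"

definition stationary :: "'a measure \<Rightarrow> ('a \<Rightarrow> 'a) \<Rightarrow> bool" where
  "stationary M T \<longleftrightarrow> T \<in> M \<rightarrow>\<^sub>M M \<and> distr M M T = M"

definition ergodic :: "'a measure \<Rightarrow> ('a \<Rightarrow> 'a) \<Rightarrow> bool" where
  "ergodic M T \<longleftrightarrow>
     (\<forall>A\<in>sets M. T -` A \<inter> space M = A \<longrightarrow> measure M A = 0 \<or> measure M A = 1)"

definition env_cond :: "env measure \<Rightarrow> env measure" where
  "env_cond Q = uniform_measure Q {\<omega>\<in>space Q. \<omega> 0}"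

text \<open>The series is taken in \<^typ>\<open>ennreal\<close>, so that the bound includes its convergence.\<close>

definition tail_bound :: "env measure \<Rightarrow> real \<Rightarrow> bool" where
  "tail_bound Q C \<longleftrightarrow> (\<forall>e\<in>{e1, e2}. \<forall>N::nat. N \<ge> 1 \<longrightarrow>
     (\<Sum>j. of_nat (N + j) *
        emeasure (env_cond Q) {\<omega>\<in>space (env_cond Q). next_dist e \<omega> = enat (N + j)})
       \<le> ennreal (C / real N))"

definition path_space :: "(nat \<Rightarrow> site) measure" where
  "path_space = (\<Pi>\<^sub>M n\<in>UNIV. count_space UNIV)"

text \<open>If all four distances at \<open>v\<close> are finite, \<open>v\<close> has exactly four neighbors and each one is chosen
  with probability \<open>1/4\<close>; see \<open>pmf_step\<close> below. The other case only concerns a null set of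
  environments; letting the walk stay put there makes the quenched law total.\<close>

definition step :: "env \<Rightarrow> site \<Rightarrow> site pmf" where
  "step \<omega> v = (if \<forall>e\<in>directions. next_dist e (env_shift v \<omega>) \<noteq> \<infinity>
     then pmf_of_set (neighbors \<omega> v) else return_pmf v)"

text \<open>The law of \<open>X\<^sub>n\<close> given the history \<open>h = (X\<^sub>0, \<dots>, X\<^sub>n\<^sub>-\<^sub>1)\<close>.\<close>

definition walk_kernel :: "env \<Rightarrow> nat \<Rightarrow> (nat \<Rightarrow> site) \<Rightarrow> site measure" where
  "walk_kernel \<omega> n h =
     measure_pmf (case n of 0 \<Rightarrow> return_pmf 0 | Suc m \<Rightarrow> step \<omega> (h m))"

text \<open>The Ionescu-Tulcea measure of these kernels; \<open>emeasure_quenched_cylinder\<close> below gives its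
  finite-dimensional distributions.\<close>

definition quenched_law :: "env \<Rightarrow> (nat \<Rightarrow> site) measure" where
  "quenched_law \<omega> = projective_family.lim UNIV
     (Ionescu_Tulcea.CI (walk_kernel \<omega>) (\<lambda>_. count_space UNIV)) (\<lambda>_. count_space UNIV)"

definition annealed_law :: "env measure \<Rightarrow> (nat \<Rightarrow> site) measure" where
  "annealed_law Q = env_cond Q \<bind> quenched_law"

definition recurrent :: "(nat \<Rightarrow> site) \<Rightarrow> bool" where
  "recurrent X \<longleftrightarrow> infinite {n. X n = 0}"

lemma space_env_space [simp]: "space env_space = UNIV"
  by (simp add: env_space_def space_PiM)

lemma space_path_space [simp]: "space path_space = UNIV"
  by (simp add: path_space_def space_PiM)

lemma next_dist_eq_enat_iff:
  "next_dist e \<omega> = enat k \<longleftrightarrow> 0 < k \<and> \<omega> (k \<cdot>\<^sub>s e) \<and> (\<forall>j. 0 < j \<and> j < k \<longrightarrow> \<not> \<omega> (j \<cdot>\<^sub>s e))"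
proof -
  let ?S = "{k. 0 < k \<and> \<omega> (k \<cdot>\<^sub>s e)}"
  show ?thesis
  proof (cases "?S = {}")
    case True
    then have "next_dist e \<omega> = \<infinity>"
      by (simp only: next_dist_def image_empty) (simp add: top_enat_def)
    with True show ?thesis by auto
  next
    case False
    define m where "m = (LEAST k. k \<in> ?S)"
    from False have m: "m \<in> ?S" and le: "\<And>j. j \<in> ?S \<Longrightarrow> m \<le> j"
      unfolding m_def by (metis LeastI ex_in_conv) (rule Least_le)
    have "next_dist e \<omega> = enat m"
      unfolding next_dist_def
      by (rule antisym[OF INF_lower[OF m] INF_greatest]) (use le in auto)
    with m le show ?thesis
      by (metis (no_types, lifting) enat.inject linorder_neqE_nat mem_Collect_eq not_le)
  qed
qed

lemma card_directions: "card directions = 4"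
  by (simp add: directions_def e1_def e2_def)

lemma inj_on_smult_directions:
  assumes "\<And>e. e \<in> directions \<Longrightarrow> 0 < k e"
  shows "inj_on (\<lambda>e. v + k e \<cdot>\<^sub>s e) directions"
  using assms by (force simp: inj_on_def directions_def smult_site_def e1_def e2_def)

lemma neighbors_finite_dist:
  assumes "\<forall>e\<in>directions. next_dist e (env_shift v \<omega>) \<noteq> \<infinity>"
  shows "card (neighbors \<omega> v) = 4"
proof -
  define k where "k e = the_enat (next_dist e (env_shift v \<omega>))" for e
  have k: "next_dist e (env_shift v \<omega>) = enat (k e)" if "e \<in> directions" for e
    using assms that unfolding k_def by (cases "next_dist e (env_shift v \<omega>)") auto
  have "neighbors \<omega> v = (\<lambda>e. v + k e \<cdot>\<^sub>s e) ` directions"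
    unfolding neighbors_def using k by (auto simp del: split_paired_All split_paired_Ex)
  moreover have "0 < k e" if "e \<in> directions" for e
    using k[OF that] by (simp add: next_dist_eq_enat_iff)
  ultimately show ?thesis
    using card_image[OF inj_on_smult_directions[of k v]] card_directions by simp
qed

lemma pmf_step:
  assumes "\<forall>e\<in>directions. next_dist e (env_shift v \<omega>) \<noteq> \<infinity>"
  shows "pmf (step \<omega> v) u = (if u \<in> neighbors \<omega> v then 1 / 4 else 0)"
proof -
  have c: "card (neighbors \<omega> v) = 4" using neighbors_finite_dist[OF assms] .
  then have "finite (neighbors \<omega> v)" "neighbors \<omega> v \<noteq> {}"
    by (auto intro: card_ge_0_finite)
  with assms c show ?thesis by (simp add: step_def indicator_def)
qed

lemma Ionescu_Tulcea_walk_kernel: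
  "Ionescu_Tulcea (walk_kernel \<omega>) (\<lambda>_. count_space UNIV)"
proof (rule Ionescu_Tulcea.intro)
  fix i
  show "walk_kernel \<omega> i \<in> PiM {0..<i} (\<lambda>_. count_space UNIV) \<rightarrow>\<^sub>M subprob_algebra (count_space UNIV)"
  proof (cases i)
    case 0
    then have "walk_kernel \<omega> i = (\<lambda>_. measure_pmf (return_pmf 0))"
      by (auto simp: walk_kernel_def)
    then show ?thesis
      by (auto simp: space_subprob_algebra intro!: measurable_const
            prob_space_imp_subprob_space prob_space_measure_pmf)
  next
    case (Suc m)
    have "(\<lambda>h. h m) \<in> PiM {0..<i} (\<lambda>_. count_space UNIV) \<rightarrow>\<^sub>M count_space (UNIV :: site set)"
      using Suc by (intro measurable_component_singleton) auto
    moreover have "(\<lambda>v. measure_pmf (step \<omega> v)) \<in> count_space UNIV \<rightarrow>\<^sub>M subprob_algebra (count_space UNIV)"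
      by (auto simp: space_subprob_algebra intro!: prob_space_imp_subprob_space prob_space_measure_pmf)
    ultimately have "(\<lambda>h. measure_pmf (step \<omega> (h m))) \<in> PiM {0..<i} (\<lambda>_. count_space UNIV)
        \<rightarrow>\<^sub>M subprob_algebra (count_space UNIV)"
      by (rule measurable_compose)
    then show ?thesis using Suc by (simp add: walk_kernel_def[abs_def])
  qed
next
  fix i h
  show "prob_space (walk_kernel \<omega> i h)"
    by (simp add: walk_kernel_def prob_space_measure_pmf)
qed

lemma sets_quenched_law [simp]: "sets (quenched_law \<omega>) = sets path_space"
proof -
  interpret Ionescu_Tulcea "walk_kernel \<omega>" "\<lambda>_. count_space UNIV"
    by (rule Ionescu_Tulcea_walk_kernel)
  show ?thesis by (simp add: quenched_law_def path_space_def PF.sets_lim)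
qed

lemma space_quenched_law [simp]: "space (quenched_law \<omega>) = UNIV"
  using sets_eq_imp_space_eq[OF sets_quenched_law] by simp

lemma path_cylinder_sets: "{X. \<forall>i\<le>n. X i = x i} \<in> sets path_space"
proof -
  have "{X \<in> space path_space. \<forall>i\<in>{..n}. X i = x i} \<in> sets path_space"
    unfolding path_space_def by measurable
  then show ?thesis by (simp add: atMost_def)
qed

text \<open>The initial law and the transition probabilities of the Markov chain.\<close>

lemma emeasure_quenched_cylinder:
  "emeasure (quenched_law \<omega>) {X. \<forall>i\<le>n. X i = x i} =
     indicator {0} (x 0) * (\<Prod>i<n. ennreal (pmf (step \<omega> (x i)) (x (Suc i))))"
proof -
  interpret Ionescu_Tulcea "walk_kernel \<omega>" "\<lambda>_. count_space UNIV"
    by (rule Ionescu_Tulcea_walk_kernel)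
  let ?M = "\<lambda>_::nat. count_space (UNIV :: site set)"
  let ?r = "\<lambda>n. restrict x {0..<n}"
  have sng: "{?r n} \<in> sets (PiM {0..<n} ?M)" for n
  proof -
    have "{?r n} = PiE {0..<n} (\<lambda>i. {x i})"
      by (auto simp: PiE_def Pi_def extensional_def fun_eq_iff restrict_def)
    then show ?thesis by (auto intro!: sets_PiM_I_finite)
  qed
  have C: "emeasure (C 0 m (\<lambda>_. undefined)) {?r m} =
      (\<Prod>i<m. emeasure (walk_kernel \<omega> i x) {x i})" for m
  proof (induction m)
    case 0
    have "{?r 0} \<in> sets (PiM {0..<0} ?M)" by (rule sng)
    then show ?case by (simp add: restrict_def)
  next
    case (Suc m)
    let ?C = "C 0 m (\<lambda>_. undefined)"
    have sp: "space ?C = space (PiM {0..<m} ?M)" using space_C[of "\<lambda>_. undefined" 0 m] by simp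
    have st: "sets ?C = sets (PiM {0..<m} ?M)" using sets_C[of "\<lambda>_. undefined" 0 m] by simp
    have ker: "walk_kernel \<omega> m (?r m) = walk_kernel \<omega> m x"
      by (auto simp: walk_kernel_def split: nat.splits)
    have eP: "emeasure (eP m h) {?r (Suc m)} =
        emeasure (walk_kernel \<omega> m x) {x m} * indicator {?r m} h"
      if h: "h \<in> space (PiM {0..<m} ?M)" for h
    proof -
      have hm: "h m = undefined" using h by (auto simp: space_PiM PiE_def extensional_def)
      have upd: "h(m := y) = ?r (Suc m) \<longleftrightarrow> h = ?r m \<and> y = x m" for y
      proof
        assume eq: "h(m := y) = ?r (Suc m)"
        have "h j = ?r m j" for j
          using fun_cong[OF eq, of j] hm by (cases "j = m") (auto simp: restrict_def)
        with fun_cong[OF eq, of m] show "h = ?r m \<and> y = x m" by auto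
      qed (auto simp: fun_eq_iff restrict_def)
      have "(\<lambda>y. h(m := y)) -` {?r (Suc m)} \<inter> space (?M m) = (if h = ?r m then {x m} else {})"
        using upd by auto
      then show ?thesis
        using emeasure_eP[OF h sng[of "Suc m"]] ker by (auto split: split_indicator)
    qed
    have "emeasure (C 0 (Suc m) (\<lambda>_. undefined)) {?r (Suc m)} =
        (\<integral>\<^sup>+h. emeasure (eP m h) {?r (Suc m)} \<partial>?C)"
      unfolding C.simps
      by (subst emeasure_bind[where N="PiM {0..<Suc m} ?M"])
         (auto simp: sng sp space_PiM measurable_cong_sets[OF st refl] intro!: measurable_eP)
    also have "\<dots> = (\<integral>\<^sup>+h. emeasure (walk_kernel \<omega> m x) {x m} * indicator {?r m} h \<partial>?C)"
      by (intro nn_integral_cong eP) (simp add: sp)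
    also have "\<dots> = emeasure (walk_kernel \<omega> m x) {x m} * emeasure ?C {?r m}"
      by (rule nn_integral_cmult_indicator) (simp add: st sng)
    finally show ?case unfolding prod.lessThan_Suc Suc by (simp only: mult.commute)
  qed
  have emb: "PF.emb UNIV {0..<Suc n} {?r (Suc n)} = {X. \<forall>i\<le>n. X i = x i}"
  proof -
    have "restrict X {0..<Suc n} = ?r (Suc n) \<longleftrightarrow> (\<forall>i\<le>n. X i = x i)" for X
      using restrict_ext[of "{0..<Suc n}" X x] fun_cong[of "restrict X {0..<Suc n}" "?r (Suc n)"]
      by (metis atLeastLessThan_iff le0 less_Suc_eq_le restrict_apply')
    then show ?thesis by (simp add: prod_emb_def space_PiM vimage_def)
  qed
  have "emeasure (quenched_law \<omega>) {X. \<forall>i\<le>n. X i = x i} = emeasure (CI {0..<Suc n}) {?r (Suc n)}"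
    unfolding quenched_law_def emb[symmetric] by (rule lim) (auto simp: sng)
  also have "\<dots> = emeasure (C 0 (Suc n) (\<lambda>_. undefined)) {?r (Suc n)}"
  proof -
    have "PF.emb {0..<Suc n} {0..<Suc n} {?r (Suc n)} = {?r (Suc n)}"
      by (rule prod_emb_id) (auto simp: space_PiM)
    then show ?thesis using emeasure_CI[OF subset_refl sng[of "Suc n"]] by simp
  qed
  also have "\<dots> = (\<Prod>i<Suc n. emeasure (walk_kernel \<omega> i x) {x i})" by (rule C)
  also have "\<dots> = indicator {0} (x 0) * (\<Prod>i<n. ennreal (pmf (step \<omega> (x i)) (x (Suc i))))"
    by (subst prod.lessThan_Suc_shift)
       (auto simp: walk_kernel_def emeasure_pmf_single split: split_indicator)
  finally show ?thesis .
qed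

lemma prob_space_quenched_law: "prob_space (quenched_law \<omega>)"
proof -
  interpret Ionescu_Tulcea "walk_kernel \<omega>" "\<lambda>_. count_space UNIV"
    by (rule Ionescu_Tulcea_walk_kernel)
  have "emeasure (quenched_law \<omega>) (PF.emb UNIV {} (space (PiM {} (\<lambda>_. count_space UNIV))))
      = emeasure (CI {}) (space (PiM {} (\<lambda>_. count_space UNIV)))"
    unfolding quenched_law_def by (rule lim) auto
  also have "\<dots> = 1"
    using prob_space.emeasure_space_1[OF PF.prob_space_P[of "{}"]] by (simp add: CI_def)
  finally show ?thesis
    by (intro prob_spaceI) (simp add: prod_emb_def space_PiM restrict_def vimage_def)
qed

lemma measurable_env_coord [measurable]: "(\<lambda>\<omega>. \<omega> x) \<in> env_space \<rightarrow>\<^sub>M count_space UNIV"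
  unfolding env_space_def by (rule measurable_component_singleton) simp

lemma measurable_env_shift [measurable]: "env_shift x \<in> env_space \<rightarrow>\<^sub>M env_space"
proof -
  have "(\<lambda>\<omega> y. \<omega> (x + y)) \<in> env_space \<rightarrow>\<^sub>M (\<Pi>\<^sub>M x\<in>UNIV. count_space UNIV)"
    by (rule measurable_PiM_single') (auto intro: measurable_env_coord)
  moreover have "env_shift x = (\<lambda>\<omega> y. \<omega> (x + y))" by (simp add: env_shift_def fun_eq_iff)
  ultimately show ?thesis by (simp add: env_space_def)
qed

lemma measurable_next_dist [measurable]:
  "Measurable.pred env_space (\<lambda>\<omega>. next_dist e \<omega> = enat k)"
  unfolding next_dist_eq_enat_iff by measurable

lemma measurable_pmf_step [measurable]:
  "(\<lambda>\<omega>. ennreal (pmf (step \<omega> v) u)) \<in> borel_measurable env_space"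
proof -
  have [measurable]: "Measurable.pred env_space (\<lambda>\<omega>. next_dist e (env_shift v \<omega>) = enat k)" for e k
    by (rule measurable_compose[OF measurable_env_shift measurable_next_dist])
  have fin: "finite directions" by (simp add: directions_def)
  have [measurable]:
    "Measurable.pred env_space (\<lambda>\<omega>. \<forall>e\<in>directions. \<exists>k. next_dist e (env_shift v \<omega>) = enat k)"
    "Measurable.pred env_space
       (\<lambda>\<omega>. \<exists>e\<in>directions. \<exists>k. u = v + k \<cdot>\<^sub>s e \<and> next_dist e (env_shift v \<omega>) = enat k)"
    using fin by measurable
  have "pmf (step \<omega> v) u =
      (if \<forall>e\<in>directions. \<exists>k. next_dist e (env_shift v \<omega>) = enat k
       then if \<exists>e\<in>directions. \<exists>k. u = v + k \<cdot>\<^sub>s e \<and> next_dist e (env_shift v \<omega>) = enat k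
         then 1 / 4 else 0
       else indicator {u} v)" for \<omega>
  proof (cases "\<forall>e\<in>directions. next_dist e (env_shift v \<omega>) \<noteq> \<infinity>")
    case True
    moreover from True have "\<forall>e\<in>directions. \<exists>k. next_dist e (env_shift v \<omega>) = enat k" by auto
    moreover have "u \<in> neighbors \<omega> v \<longleftrightarrow>
        (\<exists>e\<in>directions. \<exists>k. u = v + k \<cdot>\<^sub>s e \<and> next_dist e (env_shift v \<omega>) = enat k)"
      by (auto simp: neighbors_def)
    ultimately show ?thesis using pmf_step[OF True] by simp
  next
    case False
    then have "\<not> (\<forall>e\<in>directions. \<exists>k. next_dist e (env_shift v \<omega>) = enat k)"
      by (metis enat.distinct(1))
    with False show ?thesis by (auto simp: step_def split: split_indicator)
  qed
  then show ?thesis by simp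
qed

lemma sets_path_space_eq:
  "sets path_space = sigma_sets UNIV (insert {} {{X. \<forall>i\<le>n. X i = x i} | n x. True})"
    (is "_ = sigma_sets UNIV ?G")
proof
  show "sigma_sets UNIV ?G \<subseteq> sets path_space"
    using sets.sigma_sets_subset[of ?G path_space] path_cylinder_sets by auto
  interpret S: sigma_algebra UNIV "sigma_sets UNIV ?G"
    by (rule sigma_algebra_sigma_sets) auto
  have coord: "{X. X n \<in> A} \<in> sigma_sets UNIV ?G" for n :: nat and A :: "site set"
  proof -
    define Y where "Y = {xs :: site list. length xs = Suc n \<and> xs ! n \<in> A}"
    have "{X. X n \<in> A} = (\<Union>xs\<in>Y. {X. \<forall>i\<le>n. X i = xs ! i})"
    proof (intro set_eqI iffI)
      fix X assume "X \<in> {X. X n \<in> A}"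
      then have "map X [0..<Suc n] \<in> Y" "\<forall>i\<le>n. X i = map X [0..<Suc n] ! i"
        by (auto simp: Y_def less_Suc_eq_le nth_append simp del: upt_Suc)
      then show "X \<in> (\<Union>xs\<in>Y. {X. \<forall>i\<le>n. X i = xs ! i})" by blast
    qed (auto simp: Y_def)
    moreover have "{X. \<forall>i\<le>n. X i = xs ! i} \<in> sigma_sets UNIV ?G" for xs
      by (rule sigma_sets.Basic) blast
    ultimately show ?thesis by (simp only: S.countable_UN''[OF countableI_type])
  qed
  have "sets path_space \<subseteq> sets (sigma UNIV ?G)"
  proof -
    have "(\<lambda>X. X) \<in> sigma UNIV ?G \<rightarrow>\<^sub>M path_space"
      unfolding path_space_def
    proof (rule measurable_PiM_single')
      show "(\<lambda>X. X i) \<in> sigma UNIV ?G \<rightarrow>\<^sub>M count_space UNIV" for i :: nat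
        using coord[of i] by (auto simp: measurable_def vimage_def)
    qed (auto simp: space_PiM)
    from measurable_sets[OF this] show ?thesis by auto
  qed
  then show "sets path_space \<subseteq> sigma_sets UNIV ?G" by simp
qed

lemma measurable_quenched_law [measurable]:
  "quenched_law \<in> env_space \<rightarrow>\<^sub>M subprob_algebra path_space"
proof (rule measurable_subprob_algebra_generated)
  let ?G = "insert {} {{X. \<forall>i\<le>n. X i = x i} | n x. True} :: (nat \<Rightarrow> site) set set"
  show "sets path_space = sigma_sets UNIV ?G" by (rule sets_path_space_eq)
  have cyl: "{X. \<forall>i\<le>n. X i = x i} \<inter> {X. \<forall>i\<le>m. X i = y i} \<in> ?G" (is "?A \<inter> ?B \<in> _")
    for n m and x y :: "nat \<Rightarrow> site"
  proof (cases "?A \<inter> ?B = {}")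
    case False
    then obtain Z where Z: "Z \<in> ?A" "Z \<in> ?B" by auto
    have "?A \<inter> ?B = {X. \<forall>i\<le>max n m. X i = Z i}" using Z by (auto simp: le_max_iff_disj)
    then show ?thesis by blast
  qed auto
  show "Int_stable ?G"
  proof (rule Int_stableI)
    fix a b assume a: "a \<in> ?G" and b: "b \<in> ?G"
    show "a \<inter> b \<in> ?G"
    proof (cases "a = {} \<or> b = {}")
      case False
      with a b obtain n x m y where "a = {X. \<forall>i\<le>n. X i = x i}" "b = {X. \<forall>i\<le>m. X i = y i}"
        by blast
      then show ?thesis using cyl[of n x m y] by (simp only:)
    qed auto
  qed
  show "?G \<subseteq> Pow UNIV" by simp
  show "subprob_space (quenched_law \<omega>)" for \<omega>
    by (rule prob_space_imp_subprob_space[OF prob_space_quenched_law])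
  show "sets (quenched_law \<omega>) = sets path_space" for \<omega> by simp
  show "(\<lambda>\<omega>. emeasure (quenched_law \<omega>) A) \<in> borel_measurable env_space" if "A \<in> ?G" for A
  proof (cases "A = {}")
    case False
    with that obtain n x where "A = {X. \<forall>i\<le>n. X i = x i}" by auto
    then show ?thesis by (simp add: emeasure_quenched_cylinder)
  qed simp
  have "emeasure (quenched_law \<omega>) UNIV = 1" for \<omega>
    using prob_space.emeasure_space_1[OF prob_space_quenched_law] by simp
  then show "(\<lambda>\<omega>. emeasure (quenched_law \<omega>) UNIV) \<in> borel_measurable env_space" by simp
qed

lemma sets_env_cond: "sets (env_cond Q) = sets Q"
  by (simp add: env_cond_def)

lemma emeasure_annealed_law:
  assumes "sets Q = sets env_space" and "G \<in> sets path_space"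
  shows "emeasure (annealed_law Q) G = (\<integral>\<^sup>+\<omega>. emeasure (quenched_law \<omega>) G \<partial>env_cond Q)"
proof -
  have st: "sets (env_cond Q) = sets env_space" using assms by (simp add: sets_env_cond)
  then have "space (env_cond Q) \<noteq> {}" using sets_eq_imp_space_eq[OF st] by simp
  then show ?thesis
    unfolding annealed_law_def
    by (rule emeasure_bind[OF _ _ assms(2)]) (simp add: measurable_cong_sets[OF st refl])
qed

lemma emeasure_origin_pos:
  assumes "prob_space Q" and sets: "sets Q = sets env_space"
    and stat: "stationary Q (env_shift e1)" "stationary Q (env_shift e2)"
    and nonempty: "measure Q {\<omega>\<in>space Q. points \<omega> = {}} < 1"
  shows "emeasure Q {\<omega>\<in>space Q. \<omega> 0} > 0"
proof (rule ccontr)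
  interpret prob_space Q by fact
  assume "\<not> ?thesis"
  then have zero: "emeasure Q {\<omega>. \<omega> 0} = 0"
    using sets_eq_imp_space_eq[OF sets] by simp
  have sp: "space Q = UNIV" using sets_eq_imp_space_eq[OF sets] by simp
  have meas: "{\<omega>. \<omega> x} \<in> sets Q" for x
    using measurable_sets[OF measurable_env_coord[of x], of "{True}"] by (simp add: sets vimage_def)
  have step: "emeasure Q {\<omega>. \<omega> (e + x)} = emeasure Q {\<omega>. \<omega> x}" if "e \<in> {e1, e2}" for e x
  proof -
    have "stationary Q (env_shift e)" using that stat by auto
    then have "emeasure Q {\<omega>. \<omega> x} = emeasure (distr Q Q (env_shift e)) {\<omega>. \<omega> x}"
      by (simp add: stationary_def)
    also have "\<dots> = emeasure Q (env_shift e -` {\<omega>. \<omega> x} \<inter> space Q)"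
      using \<open>stationary Q (env_shift e)\<close> meas by (intro emeasure_distr) (auto simp: stationary_def)
    also have "env_shift e -` {\<omega>. \<omega> x} \<inter> space Q = {\<omega>. \<omega> (e + x)}" by (auto simp: sp env_shift_def)
    finally show ?thesis by simp
  qed
  have h: "emeasure Q {\<omega>. \<omega> (a, b)} = emeasure Q {\<omega>. \<omega> (0, b)}" for a b
  proof (induction a rule: int_induct[where k=0])
    case (step1 i) then show ?case using step[of e1 "(i, b)"] by (simp add: e1_def add.commute)
  next
    case (step2 i) then show ?case using step[of e1 "(i - 1, b)"] by (simp add: e1_def)
  qed simp
  have v: "emeasure Q {\<omega>. \<omega> (0, b)} = emeasure Q {\<omega>. \<omega> (0, 0)}" for b
  proof (induction b rule: int_induct[where k=0])
    case (step1 i) then show ?case using step[of e2 "(0, i)"] by (simp add: e2_def add.commute)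
  next
    case (step2 i) then show ?case using step[of e2 "(0, i - 1)"] by (simp add: e2_def)
  qed simp
  have "emeasure Q {\<omega>. \<omega> x} = 0" for x
    using h[of "fst x" "snd x"] v[of "snd x"] zero by (simp add: zero_prod_def)
  then have "AE \<omega> in Q. \<not> \<omega> x" for x
    using AE_iff_measurable[of "{\<omega>. \<omega> x}" Q "\<lambda>\<omega>. \<not> \<omega> x"] meas by (simp add: sp)
  then have "AE \<omega> in Q. \<forall>x. \<not> \<omega> x" by (simp add: AE_all_countable)
  then have "AE \<omega> in Q. points \<omega> = {}" by (simp add: points_def)
  moreover have "{\<omega>\<in>space Q. points \<omega> = {}} \<in> sets Q"
  proof -
    have "{\<omega>\<in>space Q. points \<omega> = {}} = space Q - (\<Union>x. {\<omega>. \<omega> x})" by (auto simp: points_def)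
    then show ?thesis using meas by auto
  qed
  ultimately have "measure Q {\<omega>\<in>space Q. points \<omega> = {}} = 1"
    using prob_Collect_eq_1 by auto
  with nonempty show False by simp
qed

lemma prob_space_annealed_law:
  assumes "prob_space Q" and "sets Q = sets env_space"
    and "stationary Q (env_shift e1)" "stationary Q (env_shift e2)"
    and "measure Q {\<omega>\<in>space Q. points \<omega> = {}} < 1"
  shows "prob_space (annealed_law Q)"
proof -
  interpret prob_space Q by fact
  have st: "sets (env_cond Q) = sets env_space" using assms by (simp add: sets_env_cond)
  have "prob_space (env_cond Q)"
    unfolding env_cond_def
    using emeasure_origin_pos[OF assms] by (intro prob_space_uniform_measure) auto
  then show ?thesis
    unfolding annealed_law_def
    by (rule prob_space.prob_space_bind[where S=path_space])
       (auto simp: prob_space_quenched_law measurable_cong_sets[OF st refl])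
qed

end

theory Submission
  imports Defs
begin

text \<open>Almost every environment turns the coordinate neighbor relation into two pairs of mutually
  inverse bijections of the set of points, so the walk is reversible. If the Green function at the
  origin were finite, Cauchy-Schwarz for the Dirichlet form would bound from below the energy of
  every finitely supported function that is 1 at the origin. To exclude this, spread each jump of
  length \<open>k\<close> over \<open>k\<close> unit edges in series, each of conductance \<open>k\<close>. By stationarity the tail
  assumption says that the conductances of the unit edges have Cauchy tails, so the \<open>O(n)\<close> edges
  that leave the ball of radius \<open>n\<close> have total conductance \<open>O(n log n)\<close> with high probability, and
  the Nash-Williams series diverges almost surely.\<close>

section \<open>Sums of random variables with Cauchy tails\<close>

text \<open>The conductance \<open>k\<close> is forced: \<open>k\<close> resistors of conductance
  \<open>k\<close> in series amount to one of conductance 1, and Cauchy-Schwarz along the interval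
  then bounds the energy of a jump by that of its unit edges. A fixed unit edge can sit at
  \<open>k\<close> positions inside an interval of length \<open>k\<close>, so by stationarity such
  an interval covers it with probability at most \<open>k\<close> times that of
  \<open>f = k\<close>; this size bias explains the factor \<open>k\<close> in the tail assumption.
  The obstacle is that different edges may depend on each other arbitrarily and that Cauchy tails
  allow infinite means. One therefore only controls each sphere separately, with an exceptional
  probability that is small uniformly in \<open>n\<close> but not summable. This still suffices: if
  the Nash-Williams series stayed bounded on an event of positive probability, integrating over that
  event would bound the divergent series of \<open>1 / (n log n)\<close>. On the analytic side, the
  Green function is replaced by its partial sums. These have finite support, so every summation by
  parts is a finite computation, and the error is one boundary term that tends to 0.\<close>

lemma harm_le_ln:
  assumes "n > 0"
  shows "harm n \<le> 1 + ln (real n)"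
proof -
  obtain m where m: "n = Suc m" using assms gr0_implies_Suc by blast
  have "harm (Suc m) - ln (real (Suc m)) \<le> harm (Suc 0) - ln (real (Suc 0))"
    using decseq_harm_diff_ln[unfolded decseq_def] by blast
  then show ?thesis by (simp add: m harm_def)
qed

text \<open>Cauchy condensation: the condensed terms are \<open>1 / (1 + n * ln 2)\<close>, which
  dominate \<open>1 / (n + 1)\<close> because \<open>ln 2 \<le> 1\<close>. The 1 added to the
  logarithm keeps the first denominator away from 0.\<close>

lemma not_summable_inverse_n_ln:
  "\<not> summable (\<lambda>n. 1 / (real (Suc n) * (1 + ln (real (Suc n)))))"
proof
  define f where "f n = (if n = 0 then 0 else 1 / (real n * (1 + ln (real n))))" for n
  assume "summable (\<lambda>n. 1 / (real (Suc n) * (1 + ln (real (Suc n)))))"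
  then have "summable (\<lambda>n. f (Suc n))" by (simp add: f_def)
  then have "summable f" by (simp only: summable_Suc_iff)
  moreover have "summable f \<longleftrightarrow> summable (\<lambda>n. 2^n * f (2^n))"
  proof (rule condensation_test)
    fix m :: nat assume "0 < m"
    then have "real m * (1 + ln (real m)) \<le> real (Suc m) * (1 + ln (real (Suc m)))"
      by (intro mult_mono) auto
    moreover have "0 < real m * (1 + ln (real m))"
      using \<open>0 < m\<close> by (intro mult_pos_pos add_pos_nonneg) auto
    ultimately show "f (Suc m) \<le> f m"
      unfolding f_def using \<open>0 < m\<close> by (simp add: frac_le del: of_nat_Suc)
  qed (auto simp: f_def)
  ultimately have sum: "summable (\<lambda>n. 2^n * f (2^n))" by blast
  have "summable (\<lambda>n. 1 / real (Suc n))"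
  proof (rule summable_comparison_test'[OF sum])
    fix n :: nat
    have "ln (2::real) \<le> 1" using ln_add_one_self_le_self[of 1] by simp
    then have "1 + real n * ln 2 \<le> real (Suc n)" using mult_left_mono[of "ln 2" 1 "real n"] by simp
    then have "1 / real (Suc n) \<le> 1 / (1 + real n * ln 2)"
      by (intro divide_left_mono mult_pos_pos add_pos_nonneg) auto
    also have "\<dots> = 2^n * f (2^n)" by (simp add: f_def ln_realpow)
    finally show "norm (1 / real (Suc n)) \<le> 2^n * f (2^n)" by simp
  qed
  then have "summable (\<lambda>n. 1 / real n)" using summable_Suc_iff[of "\<lambda>n. 1 / real n"] by simp
  then show False using not_summable_harmonic[where 'a=real] by (simp add: inverse_eq_divide)
qed

lemma (in finite_measure) integrable_indicator_event:
  "A \<in> sets M \<Longrightarrow> integrable M (indicator A :: 'a \<Rightarrow> real)"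
  by (intro integrable_real_indicator) (simp_all add: less_top emeasure_eq_measure)

text \<open>Only the law of each single \<open>D n\<close> enters. Outside an event of probability
  at most \<open>\<epsilon>\<close>, \<open>1 / b n \<le> K / D n\<close>; integrating this over the
  event \<open>F R\<close> that all partial sums of \<open>1 / D n\<close> are at most
  \<open>R\<close> shows that \<open>F R\<close> has probability at most \<open>\<epsilon>\<close>,
  for every \<open>\<epsilon>\<close>.\<close>

lemma (in prob_space) AE_not_summable_inverse:
  fixes D :: "nat \<Rightarrow> 'a \<Rightarrow> real" and b :: "nat \<Rightarrow> real"
  assumes meas [measurable]: "\<And>n. D n \<in> borel_measurable M"
    and D: "\<And>n \<omega>. D n \<omega> > 0" and b: "\<And>n. b n > 0" "\<not> summable (\<lambda>n. 1 / b n)"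
    and tight: "\<And>\<epsilon>. \<epsilon> > 0 \<Longrightarrow> \<exists>K>0. \<forall>n. prob {\<omega>\<in>space M. D n \<omega> > K * b n} \<le> \<epsilon>"
  shows "AE \<omega> in M. \<not> summable (\<lambda>n. 1 / D n \<omega>)"
proof -
  define F where "F R = {\<omega>\<in>space M. \<forall>N. (\<Sum>n<N. 1 / D n \<omega>) \<le> real R}" for R :: nat
  have F_sets [measurable]: "F R \<in> sets M" for R unfolding F_def by measurable
  have F_le: "prob (F R) \<le> \<epsilon>" if "\<epsilon> > 0" for R \<epsilon>
  proof (rule ccontr)
    assume "\<not> prob (F R) \<le> \<epsilon>"
    then have pos: "prob (F R) - \<epsilon> > 0" by simp
    obtain K where K: "K > 0" and tail: "\<And>n. prob {\<omega>\<in>space M. D n \<omega> > K * b n} \<le> \<epsilon>"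
      using tight[OF \<open>\<epsilon> > 0\<close>] by blast
    define A where "A n = {\<omega>\<in>space M. D n \<omega> > K * b n}" for n
    have A_sets [measurable]: "A n \<in> sets M" for n unfolding A_def by measurable
    define W where "W N = (\<Sum>n<N. 1 / b n)" for N
    have "(prob (F R) - \<epsilon>) * W N \<le> K * real R" for N
    proof -
      have pointwise: "(W N - K * real R) * indicator (F R) \<omega> \<le> (\<Sum>n<N. (1 / b n) * indicator (A n) \<omega>)"
        (is "_ \<le> ?S \<omega>") if "\<omega> \<in> space M" for \<omega>
      proof (cases "\<omega> \<in> F R")
        case True
        have "1 / b n - K * (1 / D n \<omega>) \<le> (1 / b n) * indicator (A n) \<omega>" for n
        proof (cases "\<omega> \<in> A n")
          case True
          then show ?thesis using K D[of n \<omega>] by (simp add: less_imp_le)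
        next
          case False
          then have "D n \<omega> \<le> K * b n" using that by (simp add: A_def)
          then have "1 / b n \<le> K / D n \<omega>" using D[of n \<omega>] b(1)[of n] by (simp add: field_simps)
          then show ?thesis using False by simp
        qed
        then have "(\<Sum>n<N. 1 / b n - K * (1 / D n \<omega>)) \<le> ?S \<omega>" by (intro sum_mono) blast
        moreover have "(\<Sum>n<N. 1 / b n - K * (1 / D n \<omega>)) = W N - K * (\<Sum>n<N. 1 / D n \<omega>)"
          by (simp add: W_def sum_subtractf sum_distrib_left)
        moreover have "K * (\<Sum>n<N. 1 / D n \<omega>) \<le> K * real R"
          using True K unfolding F_def by (intro mult_left_mono) auto
        ultimately show ?thesis using True by simp
      next
        case False
        then show ?thesis using b(1) by (auto intro!: sum_nonneg simp: less_imp_le)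
      qed
      have "(W N - K * real R) * prob (F R) = (\<integral>\<omega>. (W N - K * real R) * indicator (F R) \<omega> \<partial>M)"
        by simp
      also have "\<dots> \<le> (\<integral>\<omega>. (\<Sum>n<N. (1 / b n) * indicator (A n) \<omega>) \<partial>M)"
        by (rule integral_mono[OF _ _ pointwise])
           (intro Bochner_Integration.integrable_sum integrable_mult_right
             integrable_indicator_event; simp)+
      also have "\<dots> = (\<Sum>n<N. \<integral>\<omega>. (1 / b n) * indicator (A n) \<omega> \<partial>M)"
        by (rule Bochner_Integration.integral_sum) (intro integrable_mult_right integrable_indicator_event; simp)
      also have "\<dots> = (\<Sum>n<N. (1 / b n) * prob (A n))"
        by (simp add: A_def)
      also have "\<dots> \<le> (\<Sum>n<N. (1 / b n) * \<epsilon>)"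
        using tail b(1) by (intro sum_mono mult_left_mono) (auto simp: A_def less_imp_le)
      also have "\<dots> = \<epsilon> * W N" by (simp add: W_def sum_distrib_left mult.commute)
      finally have "(prob (F R) - \<epsilon>) * W N \<le> K * real R * prob (F R)" by (simp add: algebra_simps)
      also have "\<dots> \<le> K * real R * 1" using K by (intro mult_left_mono) auto
      finally show ?thesis by simp
    qed
    \<comment> \<open>The factor of \<open>W N\<close> is positive by assumption, so the partial
      sums of the divergent series would be bounded.\<close>
    then have "W N \<le> K * real R / (prob (F R) - \<epsilon>)" for N
      using pos by (simp add: pos_le_divide_eq mult.commute)
    then have "summable (\<lambda>n. 1 / b n)"
      unfolding W_def using b(1) by (intro summableI_nonneg_bounded) (auto simp: less_imp_le)
    with b(2) show False by simp
  qed
  have "prob (F R) = 0" for R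
    by (rule antisym[OF field_le_epsilon]) (use F_le in auto)
  then have "F R \<in> null_sets M" for R by (simp add: null_sets_def emeasure_eq_measure)
  then have "AE \<omega> in M. \<omega> \<notin> F R" for R by (rule AE_not_in)
  then have "AE \<omega> in M. \<forall>R. \<omega> \<notin> F R" by (simp add: AE_all_countable)
  then show ?thesis
  proof (rule AE_mp, intro AE_I2 impI notI)
    fix \<omega> assume "\<omega> \<in> space M" "\<forall>R. \<omega> \<notin> F R" and sum: "summable (\<lambda>n. 1 / D n \<omega>)"
    obtain R :: nat where R: "(\<Sum>n. 1 / D n \<omega>) \<le> real R" using real_arch_simple by blast
    have "(\<Sum>n<N. 1 / D n \<omega>) \<le> real R" for N
      using sum_le_suminf[OF sum, of "{..<N}"] D R by (force simp: less_imp_le)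
    then have "\<omega> \<in> F R" using \<open>\<omega> \<in> space M\<close> by (simp add: F_def)
    with \<open>\<forall>R. \<omega> \<notin> F R\<close> show False by blast
  qed
qed

text \<open>Sums of \<open>O(n)\<close> variables with Cauchy tails are \<open>O(n log n)\<close> with high probability: truncate
  each of them at a large multiple of \<open>n\<close>.\<close>

lemma (in prob_space) AE_not_summable_inverse_Cauchy_tails:
  fixes X :: "'i \<Rightarrow> 'a \<Rightarrow> nat" and E :: "nat \<Rightarrow> 'i set" and C :: real
  assumes meas [measurable]: "\<And>i. X i \<in> M \<rightarrow>\<^sub>M count_space UNIV"
    and fin: "\<And>n. finite (E n)" and card: "\<And>n. card (E n) \<le> a * Suc n"
    and tail: "\<And>i j n. i \<in> E n \<Longrightarrow> 1 \<le> j \<Longrightarrow> prob {\<omega>\<in>space M. j \<le> X i \<omega>} \<le> C / real j"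
    and C: "C \<ge> 0"
  shows "AE \<omega> in M. \<not> summable (\<lambda>n. 1 / (1 + (\<Sum>i\<in>E n. real (X i \<omega>))))"
proof -
  define b where "b n = real (Suc n) * (1 + ln (real (Suc n)))" for n
  let ?D = "\<lambda>n \<omega>. 1 + (\<Sum>i\<in>E n. real (X i \<omega>))"
  have b1: "1 \<le> b n" for n
    unfolding b_def using mult_mono[of 1 "real (Suc n)" 1 "1 + ln (real (Suc n))"] by simp
  have b_pos: "0 < b n" for n using b1[of n] by simp
  show ?thesis
  proof (rule AE_not_summable_inverse[where b=b])
    show "?D n \<in> borel_measurable M" for n by measurable
    show "?D n \<omega> > 0" for n \<omega> by (intro add_pos_nonneg sum_nonneg) auto
    show "b n > 0" for n by (rule b_pos)
    show "\<not> summable (\<lambda>n. 1 / b n)" unfolding b_def by (rule not_summable_inverse_n_ln)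
    fix \<epsilon> :: real assume \<epsilon>: "\<epsilon> > 0"
    \<comment> \<open>Half of \<open>\<epsilon>\<close> goes to the union bound for exceeding the
      truncation level \<open>m * Suc n\<close>, which is at most \<open>a * C / m\<close>. The
      other half goes to Markov's inequality: \<open>c * b n\<close> bounds the truncated mean, and
      \<open>K\<close> is chosen so that \<open>c / K = \<epsilon> / 2\<close>.\<close>
    obtain m :: nat where m: "real m > 2 * a * C / \<epsilon>" "m > 0"
      by (metis reals_Archimedean2 gr0I less_trans of_nat_0_less_iff not_less_iff_gr_or_eq zero_less_Suc of_nat_less_iff lessI)
    define c where "c = 1 + a * C * (1 + ln (real m))"
    define K where "K = 2 * c / \<epsilon>"
    have c: "c > 0" unfolding c_def using C m by (intro add_pos_nonneg mult_nonneg_nonneg) auto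
    then have K: "K > 0" using \<epsilon> by (simp add: K_def)
    have "prob {\<omega>\<in>space M. K * b n < ?D n \<omega>} \<le> \<epsilon>" for n
    proof -
      define L where "L = m * Suc n"
      have L: "L \<ge> 1" using m(2) by (simp add: L_def)
      define s where "s = real (Suc n)"
      have s: "s \<ge> 1" "b n = s * (1 + ln s)" "real L = real m * s"
        by (simp_all add: s_def b_def L_def algebra_simps)
      have card_s: "real (card (E n)) \<le> a * s"
        unfolding s_def using card[of n] by (metis of_nat_le_iff of_nat_mult)
      have ln_s: "ln s \<ge> 0" using s by simp
      define Y where "Y \<omega> = 1 + (\<Sum>i\<in>E n. real (min (X i \<omega>) L))" for \<omega>
      define A where "A i = {\<omega>\<in>space M. L \<le> X i \<omega>}" for i
      define B where "B = {\<omega>\<in>space M. K * b n \<le> Y \<omega>}"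
      have [measurable]: "A i \<in> sets M" for i unfolding A_def by measurable
      have [measurable]: "Y \<in> borel_measurable M" unfolding Y_def by measurable
      have [measurable]: "B \<in> sets M" unfolding B_def by measurable
      have int_min: "integrable M (\<lambda>\<omega>. real (min (X i \<omega>) L))" for i
        by (rule integrable_const_bound[where B="real L"]) auto
      have "(\<integral>\<omega>. real (min (X i \<omega>) L) \<partial>M) \<le> C * (1 + ln (real L))" if "i \<in> E n" for i
      proof -
        \<comment> \<open>Layer-cake formula: it turns the truncated mean into the sum of the tails
          up to \<open>L\<close>, hence into a harmonic sum.\<close>
        have "real (min x L) = (\<Sum>j=1..L. indicator {k. j \<le> k} x)" for x :: nat
        proof -
          have "(\<Sum>j=1..L. indicator {k. j \<le> k} x :: real) = (\<Sum>j\<in>{1..L} \<inter> {j. j \<le> x}. 1)"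
            by (simp add: sum.inter_restrict indicator_def)
          also have "{1..L} \<inter> {j. j \<le> x} = {1..min x L}" by auto
          finally show ?thesis by simp
        qed
        then have "(\<integral>\<omega>. real (min (X i \<omega>) L) \<partial>M) =
            (\<integral>\<omega>. (\<Sum>j=1..L. indicator {\<omega>\<in>space M. j \<le> X i \<omega>} \<omega>) \<partial>M)"
          by (intro Bochner_Integration.integral_cong) (auto simp: indicator_def)
      also have "\<dots> = (\<Sum>j=1..L. \<integral>\<omega>. indicator {\<omega>\<in>space M. j \<le> X i \<omega>} \<omega> \<partial>M)"
          by (rule Bochner_Integration.integral_sum) (rule integrable_indicator_event, measurable)
        also have "\<dots> = (\<Sum>j=1..L. prob {\<omega>\<in>space M. j \<le> X i \<omega>})"
          by (simp add: Int_def conj_commute cong: conj_cong)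
        also have "\<dots> \<le> (\<Sum>j=1..L. C / real j)" by (intro sum_mono tail[OF that]) auto
        also have "\<dots> = C * harm L" by (simp add: harm_def sum_distrib_left divide_inverse)
        also have "\<dots> \<le> C * (1 + ln (real L))" using L C by (intro mult_left_mono harm_le_ln) auto
        finally show ?thesis .
      qed
      then have "(\<integral>\<omega>. Y \<omega> \<partial>M) \<le> 1 + (\<Sum>i\<in>E n. C * (1 + ln (real L)))"
        unfolding Y_def using int_min
        by (simp add: Bochner_Integration.integral_sum prob_space sum_bounded_above)
      also have "\<dots> = 1 + real (card (E n)) * (C * (1 + ln (real L)))" by simp
      also have "\<dots> \<le> 1 + a * s * (C * (1 + ln (real L)))"
        using card_s C L by (intro add_mono order_refl mult_right_mono mult_nonneg_nonneg) auto
      also have "\<dots> \<le> c * b n"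
      proof -
        have "1 + ln (real L) = 1 + ln (real m) + ln s"
          using m(2) s(1) by (simp add: s(3) ln_mult)
        also have "\<dots> \<le> (1 + ln (real m)) * (1 + ln s)"
          using m(2) ln_s by (simp add: algebra_simps)
        finally have "a * s * C * (1 + ln (real L)) \<le> a * s * C * ((1 + ln (real m)) * (1 + ln s))"
          using C s(1) by (intro mult_left_mono mult_nonneg_nonneg) auto
        moreover have "c * b n = b n + a * s * C * ((1 + ln (real m)) * (1 + ln s))"
          by (simp add: c_def s(2) algebra_simps)
        ultimately show ?thesis using b1[of n] by (simp only: mult.assoc)
      qed
      finally have EY: "(\<integral>\<omega>. Y \<omega> \<partial>M) \<le> c * b n" .
      have "prob B \<le> (\<integral>\<omega>. Y \<omega> \<partial>M) / (K * b n)"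
        unfolding B_def
      proof (rule integral_Markov_inequality_measure)
        show "integrable M Y" unfolding Y_def using int_min by auto
        show "AE \<omega> in M. 0 \<le> Y \<omega>" unfolding Y_def by (intro AE_I2 add_nonneg_nonneg sum_nonneg) auto
        show "0 < K * b n" using K b_pos by simp
      qed (rule sets.top)
      also have "\<dots> \<le> c * b n / (K * b n)"
        using EY K b_pos[of n] by (intro divide_right_mono) auto
      also have "\<dots> = c / K" using b_pos[of n] by simp
      also have "\<dots> = \<epsilon> / 2" using c \<epsilon> by (simp add: K_def)
      finally have B: "prob B \<le> \<epsilon> / 2" .
      have "prob (\<Union>i\<in>E n. A i) \<le> (\<Sum>i\<in>E n. prob (A i))"
        by (rule finite_measure_subadditive_finite[OF fin]) auto
      also have "\<dots> \<le> (\<Sum>i\<in>E n. C / real L)" unfolding A_def by (intro sum_mono tail L)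
      also have "\<dots> = real (card (E n)) * (C / real L)" by simp
      also have "\<dots> \<le> a * s * (C / real L)" using card_s C by (intro mult_right_mono) auto
      also have "\<dots> = a * C / real m" using m(2) s(1) by (simp add: s(3))
      also have "\<dots> \<le> \<epsilon> / 2" using m \<epsilon> by (simp add: field_simps)
      finally have A: "prob (\<Union>i\<in>E n. A i) \<le> \<epsilon> / 2" .
      have "{\<omega>\<in>space M. K * b n < ?D n \<omega>} \<subseteq> (\<Union>i\<in>E n. A i) \<union> B"
      proof
        fix \<omega> assume \<omega>: "\<omega> \<in> {\<omega>\<in>space M. K * b n < ?D n \<omega>}"
        show "\<omega> \<in> (\<Union>i\<in>E n. A i) \<union> B"
        proof (cases "\<exists>i\<in>E n. L \<le> X i \<omega>")
          case False
          then have "?D n \<omega> = Y \<omega>" unfolding Y_def by (intro arg_cong2[where f="(+)"] refl sum.cong) auto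
          then show ?thesis using \<omega> by (simp add: B_def)
        qed (use \<omega> in \<open>auto simp: A_def\<close>)
      qed
      then have "prob {\<omega>\<in>space M. K * b n < ?D n \<omega>} \<le> prob ((\<Union>i\<in>E n. A i) \<union> B)"
        by (rule finite_measure_mono) (intro sets.Un sets.finite_UN fin; measurable)
      also have "\<dots> \<le> prob (\<Union>i\<in>E n. A i) + prob B"
        using fin by (intro measure_Un_le) auto
      finally show ?thesis using A B by simp
    qed
    then show "\<exists>K>0. \<forall>n. prob {\<omega>\<in>space M. K * b n < ?D n \<omega>} \<le> \<epsilon>" using K by blast
  qed
qed

section \<open>The Green function of a walk along bijections\<close>

lemma finite_support_comp_bij:
  assumes "bij_betw T V V" "finite {x\<in>V. f x \<noteq> (0::real)}"
  shows "finite {x\<in>V. f (T x) \<noteq> 0}"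
proof (rule finite_imageD)
  show "finite (T ` {x\<in>V. f (T x) \<noteq> 0})"
    by (rule finite_subset[OF _ assms(2)]) (use assms(1) in \<open>auto simp: bij_betw_def\<close>)
  show "inj_on T {x\<in>V. f (T x) \<noteq> 0}"
    using assms(1) by (auto simp: bij_betw_def inj_on_def)
qed

lemma summable_on_finite_support:
  "finite {x\<in>V. f x \<noteq> (0::real)} \<Longrightarrow> f summable_on V"
  by (rule finite_nonzero_values_imp_summable_on) auto

lemma infsum_diff:
  fixes f g :: "'a \<Rightarrow> real"
  assumes "f summable_on V" "g summable_on V"
  shows "(\<Sum>\<^sub>\<infinity>x\<in>V. f x - g x) = (\<Sum>\<^sub>\<infinity>x\<in>V. f x) - (\<Sum>\<^sub>\<infinity>x\<in>V. g x)"
  using infsum_add[OF assms(1) summable_on_uminus[THEN iffD2, OF assms(2)]]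
  by (simp add: infsum_uminus)

lemma infsum_sum_real:
  fixes f :: "'i \<Rightarrow> 'a \<Rightarrow> real"
  assumes "\<And>i. i \<in> I \<Longrightarrow> f i summable_on V"
  shows "(\<Sum>\<^sub>\<infinity>x\<in>V. \<Sum>i\<in>I. f i x) = (\<Sum>i\<in>I. \<Sum>\<^sub>\<infinity>x\<in>V. f i x)"
proof -
  have "(\<lambda>x. \<Sum>i\<in>I. f i x) summable_on V \<and>
      (\<Sum>\<^sub>\<infinity>x\<in>V. \<Sum>i\<in>I. f i x) = (\<Sum>i\<in>I. \<Sum>\<^sub>\<infinity>x\<in>V. f i x)"
    using assms
  proof (induction I rule: infinite_finite_induct)
    case (insert i I)
    then have "f i summable_on V" "(\<lambda>x. \<Sum>i\<in>I. f i x) summable_on V" by auto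
    with insert show ?case by (simp add: infsum_add summable_on_add)
  qed simp_all
  then show ?thesis by simp
qed

lemma finite_support_mult:
  "finite {x\<in>V. f x \<noteq> (0::real)} \<Longrightarrow> finite {x\<in>V. f x * g x \<noteq> 0}"
  by (erule rev_finite_subset) auto

text \<open>Reindexing the part with \<open>h (T x)\<close> along \<open>T\<close> moves the
  differences onto \<open>f\<close>, where the inverse \<open>S\<close> shows up. Finite support of
  \<open>h\<close> makes the separated pieces summable.\<close>

lemma summation_by_parts_bij:
  fixes h f :: "'a \<Rightarrow> real"
  assumes T: "bij_betw T V V" and S: "\<And>x. x \<in> V \<Longrightarrow> S (T x) = x"
    and h: "finite {x\<in>V. h x \<noteq> 0}" and f: "finite {x\<in>V. f x \<noteq> 0}"
  shows "(\<Sum>\<^sub>\<infinity>x\<in>V. (h (T x) - h x) * (f (T x) - f x)) =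
    (\<Sum>\<^sub>\<infinity>x\<in>V. h x * (2 * f x - f (T x) - f (S x)))"
proof -
  note hT = finite_support_comp_bij[OF T h]
  note sm = summable_on_finite_support[OF finite_support_mult[OF h]]
    summable_on_finite_support[OF finite_support_mult[OF hT]]
  have "(\<Sum>\<^sub>\<infinity>x\<in>V. (h (T x) - h x) * (f (T x) - f x)) =
      (\<Sum>\<^sub>\<infinity>x\<in>V. h (T x) * (f (T x) - f x) - h x * (f (T x) - f x))"
    by (simp add: left_diff_distrib)
  also have "\<dots> = (\<Sum>\<^sub>\<infinity>x\<in>V. h (T x) * (f (T x) - f x)) - (\<Sum>\<^sub>\<infinity>x\<in>V. h x * (f (T x) - f x))"
    by (rule infsum_diff[OF sm(2) sm(1)])
  also have "(\<Sum>\<^sub>\<infinity>x\<in>V. h (T x) * (f (T x) - f x)) = (\<Sum>\<^sub>\<infinity>x\<in>V. h (T x) * (f (T x) - f (S (T x))))"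
    by (rule infsum_cong) (simp add: S)
  also have "\<dots> = (\<Sum>\<^sub>\<infinity>x\<in>V. h x * (f x - f (S x)))"
    by (rule infsum_reindex_bij_betw[OF T])
  also have "\<dots> - (\<Sum>\<^sub>\<infinity>x\<in>V. h x * (f (T x) - f x)) =
      (\<Sum>\<^sub>\<infinity>x\<in>V. h x * (f x - f (S x)) - h x * (f (T x) - f x))"
    by (rule infsum_diff[symmetric, OF sm(1) sm(1)])
  finally show ?thesis by (simp add: algebra_simps)
qed

text \<open>Expands \<open>c * (a - b / c)^2 \<ge> 0\<close>. Every product keeps \<open>a\<close>
  or \<open>b\<close> as its first factor, so that finite support of an increment gives summability
  once this is summed over \<open>V\<close>.\<close>

lemma weighted_AM_GM:
  fixes a b c :: real
  assumes "c > 0"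
  shows "a * (2 * b) \<le> a * (c * a) + b * (b / c)"
proof -
  define d where "d = b / c"
  have b: "b = c * d" using assms by (simp add: d_def)
  have "0 \<le> c * (a - d)\<^sup>2" using assms by simp
  also have "\<dots> = a * (c * a) + (c * d) * d - a * (2 * (c * d))"
    by (simp add: power2_eq_square algebra_simps)
  finally show ?thesis by (simp only: d_def[symmetric]) (simp add: b)
qed

text \<open>The walk enters only through \<open>f n x\<close>, the probability of being at
  \<open>x\<close> after \<open>n\<close> steps from \<open>z\<close>. A step applies one of the
  \<open>2 * card I\<close> maps \<open>T i\<close>, \<open>S i\<close> uniformly; as this family is
  closed under inverses, the forward equation \<open>f_Suc\<close> averages over the same
  maps.\<close>

locale bijection_walk =
  fixes V :: "'a set" and I :: "'i set" and T S :: "'i \<Rightarrow> 'a \<Rightarrow> 'a" and z :: 'a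
    and f :: "nat \<Rightarrow> 'a \<Rightarrow> real"
  assumes fin_I: "finite I" and I_ne: "I \<noteq> {}" and z: "z \<in> V"
    and bij: "i \<in> I \<Longrightarrow> bij_betw (T i) V V"
    and inverse: "i \<in> I \<Longrightarrow> x \<in> V \<Longrightarrow> S i (T i x) = x"
    and f0: "x \<in> V \<Longrightarrow> f 0 x = (if x = z then 1 else 0)"
    and f_Suc: "x \<in> V \<Longrightarrow> f (Suc n) x = (\<Sum>i\<in>I. f n (T i x) + f n (S i x)) / (2 * card I)"
begin

definition avg :: "('a \<Rightarrow> real) \<Rightarrow> 'a \<Rightarrow> real" where
  "avg g x = (\<Sum>i\<in>I. g (T i x) + g (S i x)) / (2 * card I)"

definition pair :: "('a \<Rightarrow> real) \<Rightarrow> ('a \<Rightarrow> real) \<Rightarrow> real" where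
  "pair g h = (\<Sum>\<^sub>\<infinity>x\<in>V. g x * h x)"

abbreviation fs :: "('a \<Rightarrow> real) \<Rightarrow> bool" where
  "fs g \<equiv> finite {x\<in>V. g x \<noteq> 0}"

text \<open>The Dirichlet form with unit conductances, each edge from \<open>x\<close> to
  \<open>T i x\<close> counted once. The missing normalisation reappears as
  \<open>2 * card I\<close> in \<open>form_eq\<close>.\<close>

definition form :: "('a \<Rightarrow> real) \<Rightarrow> ('a \<Rightarrow> real) \<Rightarrow> real" where
  "form g h = (\<Sum>i\<in>I. \<Sum>\<^sub>\<infinity>x\<in>V. (g (T i x) - g x) * (h (T i x) - h x))"

lemma card_pos: "card I > 0"
  using fin_I I_ne by (simp add: card_gt_0_iff)

lemma bij_S:
  assumes i: "i \<in> I"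
  shows "bij_betw (S i) V V"
proof -
  have "S i x = inv_into V (T i) x" if "x \<in> V" for x
  proof -
    obtain y where "y \<in> V" "x = T i y" using bij[OF i] \<open>x \<in> V\<close> by (auto simp: bij_betw_def)
    then show ?thesis using bij[OF i] inverse[OF i] by (simp add: bij_betw_def inv_into_f_f)
  qed
  then show ?thesis using bij_betw_inv_into[OF bij[OF i]] bij_betw_cong by metis
qed

lemma fs_add: "fs g \<Longrightarrow> fs h \<Longrightarrow> fs (\<lambda>x. g x + h x)"
  by (rule finite_subset[of _ "{x\<in>V. g x \<noteq> 0} \<union> {x\<in>V. h x \<noteq> 0}"]) auto

lemma fs_sum: "finite A \<Longrightarrow> (\<And>a. a \<in> A \<Longrightarrow> fs (g a)) \<Longrightarrow> fs (\<lambda>x. \<Sum>a\<in>A. g a x)"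
  by (induction A rule: finite_induct) (simp_all add: fs_add)

lemma fs_avg:
  assumes "fs g"
  shows "fs (avg g)"
proof -
  have "fs (\<lambda>x. \<Sum>i\<in>I. g (T i x) + g (S i x))"
    by (rule fs_sum[OF fin_I], rule fs_add; rule finite_support_comp_bij[OF _ assms])
       (simp_all add: bij bij_S)
  then show ?thesis unfolding avg_def using card_pos by simp
qed

lemma fs_f: "fs (f n)"
proof (induction n)
  case 0
  show ?case by (rule finite_subset[of _ "{z}"]) (auto simp: f0 split: if_splits)
next
  case (Suc n)
  have "{x\<in>V. f (Suc n) x \<noteq> 0} = {x\<in>V. avg (f n) x \<noteq> 0}"
    by (auto simp: f_Suc avg_def)
  then show ?case using fs_avg[OF Suc] by simp
qed

lemma pair_commute: "pair g h = pair h g"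
  by (simp add: pair_def mult.commute)

lemma pair_z:
  assumes "\<And>x. x \<in> V \<Longrightarrow> g x = (if x = z then 1 else 0)"
  shows "pair h g = h z"
proof -
  have "pair h g = (\<Sum>\<^sub>\<infinity>x\<in>{z}. h x * g x)"
    unfolding pair_def by (rule infsum_cong_neutral) (use assms z in auto)
  then show ?thesis using assms z by simp
qed

lemma pair_diff_right:
  assumes "fs h"
  shows "pair h (\<lambda>x. g x - k x) = pair h g - pair h k"
  unfolding pair_def right_diff_distrib
  by (rule infsum_diff) (intro summable_on_finite_support finite_support_mult assms)+

text \<open>Summation by parts for each \<open>i\<close> leaves
  \<open>2 * g x - g (T i x) - g (S i x)\<close>, and summing these over \<open>I\<close> gives
  \<open>2 * card I\<close> times \<open>g x - avg g x\<close>.\<close>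

lemma form_eq:
  assumes h: "fs h" and g: "fs g"
  shows "form h g = 2 * card I * (pair h g - pair h (avg g))"
proof -
  have "form h g = (\<Sum>i\<in>I. \<Sum>\<^sub>\<infinity>x\<in>V. h x * (2 * g x - g (T i x) - g (S i x)))"
    unfolding form_def by (intro sum.cong refl summation_by_parts_bij bij inverse h g)
  also have "\<dots> = (\<Sum>\<^sub>\<infinity>x\<in>V. \<Sum>i\<in>I. h x * (2 * g x - g (T i x) - g (S i x)))"
    by (rule infsum_sum_real[symmetric]) (intro summable_on_finite_support finite_support_mult h)
  also have "\<dots> = (\<Sum>\<^sub>\<infinity>x\<in>V. (2 * card I) * (h x * (g x - avg g x)))"
  proof (rule infsum_cong)
    fix x
    have "2 * card I * avg g x = (\<Sum>i\<in>I. g (T i x) + g (S i x))"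
      using card_pos by (simp add: avg_def)
    moreover have "(\<Sum>i\<in>I. h x * (2 * g x - g (T i x) - g (S i x))) =
        h x * (2 * card I * g x - (\<Sum>i\<in>I. g (T i x) + g (S i x)))"
      unfolding sum_distrib_left[symmetric] by (simp add: sum_subtractf sum.distrib algebra_simps)
    ultimately show "(\<Sum>i\<in>I. h x * (2 * g x - g (T i x) - g (S i x))) =
        (2 * card I) * (h x * (g x - avg g x))"
      by (simp add: algebra_simps)
  qed
  also have "\<dots> = 2 * card I * pair h (\<lambda>x. g x - avg g x)"
    unfolding pair_def by (rule infsum_cmult_right')
  finally show ?thesis by (simp add: pair_diff_right h)
qed

text \<open>Self-adjointness of the transition operator, read off from the symmetry of
  \<open>form\<close>.\<close>

lemma pair_avg: "fs h \<Longrightarrow> fs g \<Longrightarrow> pair h (avg g) = pair (avg h) g"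
proof -
  assume "fs h" "fs g"
  moreover have "form h g = form g h" by (simp add: form_def mult.commute)
  ultimately show ?thesis using card_pos pair_commute[of g] by (simp add: form_eq)
qed

lemma pair_cong: "(\<And>x. x \<in> V \<Longrightarrow> g x = g' x) \<Longrightarrow> pair h g = pair h g'"
  unfolding pair_def by (intro infsum_cong) simp

text \<open>Self-adjointness shifts steps from the right argument to the left one until the unit
  mass \<open>f 0\<close> remains.\<close>

lemma pair_f: "pair (f m) (f n) = f (m + n) z"
proof (induction n arbitrary: m)
  case 0
  show ?case using pair_z[OF f0] by simp
next
  case (Suc n)
  have "pair (f m) (f (Suc n)) = pair (f m) (avg (f n))"
    by (rule pair_cong) (simp add: f_Suc avg_def)
  also have "\<dots> = pair (f n) (avg (f m))"
    by (subst pair_avg[OF fs_f fs_f]) (rule pair_commute)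
  also have "\<dots> = pair (f n) (f (Suc m))"
    by (rule pair_cong) (simp add: f_Suc avg_def)
  also have "\<dots> = f (m + Suc n) z" unfolding pair_commute[of "f n"] Suc by simp
  finally show ?case .
qed

lemma f_nonneg: "x \<in> V \<Longrightarrow> f n x \<ge> 0"
proof (induction n arbitrary: x)
  case (Suc n)
  have "T i x \<in> V" "S i x \<in> V" if "i \<in> I" for i
    using bij[OF that] bij_S[OF that] Suc.prems by (auto simp: bij_betw_def)
  then show ?case unfolding f_Suc[OF Suc.prems]
    by (intro divide_nonneg_nonneg sum_nonneg add_nonneg_nonneg Suc.IH) auto
qed (simp add: f0)

text \<open>The left side is one term of \<open>pair (f n) (f n)\<close>. Thus decay of the return
  probabilities forces decay at every point.\<close>

lemma f_square_le: "x \<in> V \<Longrightarrow> (f n x)\<^sup>2 \<le> f (n + n) z"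
proof -
  assume x: "x \<in> V"
  have "(\<Sum>\<^sub>\<infinity>y\<in>{x}. f n y * f n y) \<le> (\<Sum>\<^sub>\<infinity>y\<in>V. f n y * f n y)"
    by (rule infsum_mono_neutral)
       (use x in \<open>auto intro!: summable_on_finite_support finite_support_mult fs_f\<close>)
  then show ?thesis using pair_f[of n n] by (simp add: pair_def power2_eq_square)
qed

lemma form_AM_GM:
  assumes "fs h" "fs g" "c > 0"
  shows "2 * form h g \<le> c * form h h + form g g / c"
proof -
  have fsT: "fs (\<lambda>x. k (T i x) - k x)" if "fs k" "i \<in> I" for k i
    by (rule finite_subset[OF _ finite_UnI[OF that(1) finite_support_comp_bij[OF bij[OF that(2)] that(1)]]])
      auto
  have "2 * (\<Sum>\<^sub>\<infinity>x\<in>V. (h (T i x) - h x) * (g (T i x) - g x)) \<le>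
     c * (\<Sum>\<^sub>\<infinity>x\<in>V. (h (T i x) - h x) * (h (T i x) - h x)) +
     (\<Sum>\<^sub>\<infinity>x\<in>V. (g (T i x) - g x) * (g (T i x) - g x)) / c" if i: "i \<in> I" for i
  proof -
    have sm: "(\<lambda>x. (k (T i x) - k x) * l x) summable_on V" if "fs k" for k l
      by (intro summable_on_finite_support finite_support_mult fsT that i)
    have "(\<Sum>\<^sub>\<infinity>x\<in>V. (h (T i x) - h x) * (2 * (g (T i x) - g x))) \<le>
      (\<Sum>\<^sub>\<infinity>x\<in>V. (h (T i x) - h x) * (c * (h (T i x) - h x)) + (g (T i x) - g x) * ((g (T i x) - g x) / c))"
    proof (rule infsum_mono)
      fix x
      show "(h (T i x) - h x) * (2 * (g (T i x) - g x)) \<le>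
          (h (T i x) - h x) * (c * (h (T i x) - h x)) + (g (T i x) - g x) * ((g (T i x) - g x) / c)"
        by (rule weighted_AM_GM[OF assms(3)])
    qed (intro sm summable_on_add assms)+
    also have "\<dots> = (\<Sum>\<^sub>\<infinity>x\<in>V. (h (T i x) - h x) * (c * (h (T i x) - h x))) +
        (\<Sum>\<^sub>\<infinity>x\<in>V. (g (T i x) - g x) * ((g (T i x) - g x) / c))"
      by (intro infsum_add sm assms)
    finally show ?thesis
      unfolding mult.left_commute[of _ c] mult.left_commute[of _ 2] divide_inverse
        mult.assoc[symmetric, of _ _ "inverse c"] infsum_cmult_right' infsum_cmult_left' .
  qed
  then have "(\<Sum>i\<in>I. 2 * (\<Sum>\<^sub>\<infinity>x\<in>V. (h (T i x) - h x) * (g (T i x) - g x))) \<le>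
     (\<Sum>i\<in>I. c * (\<Sum>\<^sub>\<infinity>x\<in>V. (h (T i x) - h x) * (h (T i x) - h x)) +
     (\<Sum>\<^sub>\<infinity>x\<in>V. (g (T i x) - g x) * (g (T i x) - g x)) / c)"
    by (rule sum_mono)
  then show ?thesis
    by (simp add: form_def sum.distrib sum_distrib_left[symmetric] sum_divide_distrib[symmetric])
qed

text \<open>Were the Green function at \<open>z\<close> at most \<open>G\<close>, its partial sums
  \<open>U\<close> would have \<open>form U U \<le> d * G\<close>, while \<open>form h U\<close> is
  \<open>d * h z\<close> up to the vanishing term \<open>d * pair h (f N)\<close>. Cauchy-Schwarz
  then keeps \<open>form h h\<close> away from 0.\<close>

lemma green_function_diverges:
  assumes cap: "\<And>\<epsilon>. \<epsilon> > 0 \<Longrightarrow> \<exists>h. fs h \<and> h z = 1 \<and> form h h \<le> \<epsilon>"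
  shows "\<not> summable (\<lambda>n. f n z)"
proof
  assume sum: "summable (\<lambda>n. f n z)"
  define G where "G = (\<Sum>n. f n z) + 1"
  have G_ge: "(\<Sum>n<N. f n z) \<le> G" for N
    unfolding G_def using sum_le_suminf[OF sum, of "{..<N}"] f_nonneg[OF z] by simp
  have G: "G > 0" unfolding G_def using suminf_nonneg[OF sum] f_nonneg[OF z] by force
  define d where "d = real (2 * card I)"
  have d: "d > 0" using card_pos by (simp add: d_def)
  \<comment> \<open>With weight \<open>2 * G\<close>, \<open>form_AM_GM\<close> will give
    \<open>2 * form h U \<le> d + d / 2\<close>, so \<open>form h U\<close> misses the value
    \<open>d\<close> by at least a quarter of it.\<close>
  from cap[of "d / (2 * G)"] obtain h
    where h: "fs h" "h z = 1" "form h h \<le> d / (2 * G)" using d G by auto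
  have lim: "(\<lambda>n. f n x) \<longlonglongrightarrow> 0" if "x \<in> V" for x
  proof -
    have "filterlim (\<lambda>n. n + n) at_top (sequentially :: nat filter)"
      by (rule filterlim_subseq) (simp add: strict_mono_def)
    then have "(\<lambda>n. f (n + n) z) \<longlonglongrightarrow> 0"
      using filterlim_compose[OF summable_LIMSEQ_zero[OF sum]] by blast
    then have "(\<lambda>n. (f n x)\<^sup>2) \<longlonglongrightarrow> 0"
      by (rule Lim_null_comparison[rotated]) (use f_square_le[OF that] in simp)
    then show ?thesis by (simp add: power_tendsto_0_iff)
  qed
  have pair_h: "pair h g = (\<Sum>x | x \<in> V \<and> h x \<noteq> 0. h x * g x)" for g
    unfolding pair_def infsum_finite[OF h(1), symmetric] by (rule infsum_cong_neutral) auto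
  have "(\<lambda>N. pair h (f N)) \<longlonglongrightarrow> 0"
    unfolding pair_h by (rule tendsto_null_sum) (auto intro!: tendsto_mult_right_zero lim)
  have bound: "1 \<le> 3 / 4 + pair h (f N)" for N
  proof -
    define U where "U x = (\<Sum>n<N. f n x)" for x
    have U: "fs U" unfolding U_def by (intro fs_sum fs_f) simp
    \<comment> \<open>The Poisson equation for the truncated Green function: \<open>avg\<close>
      advances time by one, so the sum telescopes.\<close>
    have avgU: "U x - avg U x = f 0 x - f N x" if "x \<in> V" for x
    proof -
      have "avg U x = (\<Sum>i\<in>I. \<Sum>n<N. f n (T i x) + f n (S i x)) / (2 * card I)"
        unfolding avg_def U_def by (simp add: sum.distrib)
      also have "\<dots> = (\<Sum>n<N. \<Sum>i\<in>I. f n (T i x) + f n (S i x)) / (2 * card I)"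
        by (subst sum.swap) (rule refl)
      also have "\<dots> = (\<Sum>n<N. avg (f n) x)"
        unfolding avg_def by (rule sum_divide_distrib)
      also have "\<dots> = (\<Sum>n<N. f (Suc n) x)" using that by (simp add: f_Suc avg_def)
      finally show ?thesis unfolding U_def
        using sum_lessThan_telescope'[of "\<lambda>n. f n x" N] by (simp add: sum_subtractf)
    qed
    have form_U: "form k U = d * (k z - pair k (f N))" if "fs k" for k
    proof -
      have "pair k U - pair k (avg U) = pair k (\<lambda>x. f 0 x - f N x)"
        unfolding pair_diff_right[OF that, symmetric] by (rule pair_cong[OF avgU])
      then show ?thesis
        using pair_z[OF f0, of k] by (simp add: form_eq that U pair_diff_right d_def)
    qed
    have "pair U (f N) \<ge> 0"
      unfolding pair_def U_def by (intro infsum_nonneg mult_nonneg_nonneg sum_nonneg f_nonneg)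
    then have "form U U \<le> d * G"
      unfolding form_U[OF U] using G_ge[of N] d by (intro mult_left_mono) (auto simp: U_def)
    then have "form U U / (2 * G) \<le> d / 2" using G by (simp add: field_simps)
    moreover have "2 * G * form h h \<le> d" using h(3) G by (simp add: field_simps)
    ultimately have "2 * form h U \<le> d + d / 2"
      using form_AM_GM[OF h(1) U, of "2 * G"] G by linarith
    then have "d * (1 - pair h (f N)) \<le> d * (3 / 4)" unfolding form_U[OF h(1)] h(2) by simp
    then show ?thesis using d by simp
  qed
  moreover have "eventually (\<lambda>N. pair h (f N) < 1 / 4) sequentially"
    using \<open>(\<lambda>N. pair h (f N)) \<longlonglongrightarrow> 0\<close> by (rule order_tendstoD(2)) simp
  then obtain N where "pair h (f N) < 1 / 4" by (auto simp: eventually_sequentially)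
  ultimately show False using bound[of N] by linarith
qed

end

section \<open>The Markov property and recurrence of the quenched walk\<close>

text \<open>The event splits into countably many disjoint cylinders, one for each history
  \<open>xs\<close> of length \<open>n + 1\<close> that ends at \<open>y 0\<close>.
  \<open>z xs\<close> glues history and continuation at time \<open>n\<close>, and the product of
  step probabilities factors there.\<close>

lemma quenched_law_cylinder_from:
  "emeasure (quenched_law \<omega>) {X. \<forall>i\<le>m. X (n + i) = y i} =
     emeasure (quenched_law \<omega>) {X. X n = y 0} * (\<Prod>i<m. ennreal (pmf (step \<omega> (y i)) (y (Suc i))))"
proof -
  let ?M = "quenched_law \<omega>"
  let ?p = "\<lambda>u v. ennreal (pmf (step \<omega> u) v)"
  define Y where "Y = {xs :: site list. length xs = Suc n \<and> xs ! n = y 0}"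
  define z where "z xs i = (if i \<le> n then xs ! i else y (i - n))" for xs i
  define cyl where "cyl k x = {X :: nat \<Rightarrow> site. \<forall>i\<le>k. X i = x i}" for k x
  have cyl_sets: "cyl k x \<in> sets path_space" for k x
    unfolding cyl_def by (rule path_cylinder_sets)
  have UN: "emeasure ?M (\<Union>xs\<in>Y. cyl (n + k) (z xs)) =
      (\<integral>\<^sup>+xs. emeasure ?M (cyl (n + k) (z xs)) \<partial>count_space Y)" for k
  proof (rule emeasure_UN_countable)
    show "disjoint_family_on (\<lambda>xs. cyl (n + k) (z xs)) Y"
    proof (unfold disjoint_family_on_def, intro ballI impI, rule ccontr)
      fix xs xs' assume xs: "xs \<in> Y" "xs' \<in> Y" "xs \<noteq> xs'"
        and "cyl (n + k) (z xs) \<inter> cyl (n + k) (z xs') \<noteq> {}"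
      then obtain X where X: "\<forall>i\<le>n+k. X i = z xs i" "\<forall>i\<le>n+k. X i = z xs' i"
        by (auto simp: cyl_def)
      have "xs ! i = xs' ! i" if "i \<le> n" for i
        using X[rule_format, of i] that by (simp add: z_def)
      then have "xs = xs'"
        using xs by (auto simp: Y_def less_Suc_eq_le intro!: nth_equalityI)
      with xs show False by simp
    qed
  qed (auto simp: cyl_sets)
  have zn: "z xs (n + i) = y i" if "xs \<in> Y" for xs i
    using that by (auto simp: z_def Y_def)
  have set_eq: "{X. \<forall>i\<le>k. X (n + i) = y i} = (\<Union>xs\<in>Y. cyl (n + k) (z xs))" for k
  proof (intro set_eqI iffI)
    fix X assume X: "X \<in> {X. \<forall>i\<le>k. X (n + i) = y i}"
    let ?xs = "map X [0..<Suc n]"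
    have nth: "?xs ! i = X i" if "i \<le> n" for i
      using that by (subst nth_map) (auto simp del: upt_Suc)
    have "?xs \<in> Y" using X nth[of n] by (auto simp: Y_def simp del: upt_Suc)
    moreover have "X i = z ?xs i" if "i \<le> n + k" for i
    proof (cases "i \<le> n")
      case False
      have "i - n \<le> k" using that by simp
      then have "X (n + (i - n)) = y (i - n)" using X by blast
      with False show ?thesis by (simp add: z_def)
    qed (simp add: z_def nth del: upt_Suc)
    ultimately show "X \<in> (\<Union>xs\<in>Y. cyl (n + k) (z xs))" by (auto simp: cyl_def simp del: upt_Suc)
  next
    fix X assume "X \<in> (\<Union>xs\<in>Y. cyl (n + k) (z xs))"
    then show "X \<in> {X. \<forall>i\<le>k. X (n + i) = y i}" using zn by (auto simp: cyl_def)
  qed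
  have "emeasure ?M (cyl (n + m) (z xs)) =
      emeasure ?M (cyl (n + 0) (z xs)) * (\<Prod>i<m. ?p (y i) (y (Suc i)))" if "xs \<in> Y" for xs
  proof -
    have "(\<Prod>i<n + m. ?p (z xs i) (z xs (Suc i))) =
        (\<Prod>i<n. ?p (z xs i) (z xs (Suc i))) * (\<Prod>i<m. ?p (z xs (n + i)) (z xs (n + Suc i)))"
      by (induction m) (simp_all add: mult.assoc)
    then show ?thesis
      unfolding cyl_def emeasure_quenched_cylinder zn[OF that] by (simp add: mult.assoc)
  qed
  then have "(\<integral>\<^sup>+xs. emeasure ?M (cyl (n + m) (z xs)) \<partial>count_space Y) =
      (\<integral>\<^sup>+xs. emeasure ?M (cyl (n + 0) (z xs)) * (\<Prod>i<m. ?p (y i) (y (Suc i))) \<partial>count_space Y)"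
    by (intro nn_integral_cong) simp
  also have "\<dots> = (\<integral>\<^sup>+xs. emeasure ?M (cyl (n + 0) (z xs)) \<partial>count_space Y) * (\<Prod>i<m. ?p (y i) (y (Suc i)))"
    by (rule nn_integral_multc) simp
  finally have "emeasure ?M {X. \<forall>i\<le>m. X (n + i) = y i} =
      emeasure ?M {X. \<forall>i\<le>0. X (n + i) = y i} * (\<Prod>i<m. ?p (y i) (y (Suc i)))"
    unfolding set_eq UN .
  then show ?thesis by simp
qed

lemma measurable_path_coord [measurable]: "(\<lambda>X. X n) \<in> path_space \<rightarrow>\<^sub>M count_space UNIV"
  unfolding path_space_def by (rule measurable_component_singleton) simp

lemma measurable_path_shift [measurable]: "(\<lambda>X i. X (n + i)) \<in> path_space \<rightarrow>\<^sub>M path_space"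
proof -
  have "(\<lambda>X i. X (n + i)) \<in> path_space \<rightarrow>\<^sub>M (\<Pi>\<^sub>M n\<in>UNIV. count_space UNIV)"
    by (rule measurable_PiM_single') (auto intro: measurable_path_coord)
  then show ?thesis by (simp add: path_space_def)
qed

lemma path_event_sets [measurable]:
  "{X. X n = x} \<in> sets path_space" "{X. X n = x \<and> X m = y} \<in> sets path_space"
proof -
  have "{X \<in> space path_space. X n = x} \<in> sets path_space"
    "{X \<in> space path_space. X n = x \<and> X m = y} \<in> sets path_space" by measurable
  then show "{X. X n = x} \<in> sets path_space" "{X. X n = x \<and> X m = y} \<in> sets path_space" by simp_all
qed

lemma quenched_law_start: "emeasure (quenched_law \<omega>) {X. X 0 = x} = indicator {0} x"
  using emeasure_quenched_cylinder[of \<omega> 0 "\<lambda>_. x"] by simp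

lemma quenched_law_two_steps:
  "emeasure (quenched_law \<omega>) {X. X n = x \<and> X (Suc n) = y} =
     emeasure (quenched_law \<omega>) {X. X n = x} * ennreal (pmf (step \<omega> x) y)"
proof -
  have "{X. X n = x \<and> X (Suc n) = y} =
      {X :: nat \<Rightarrow> site. \<forall>i\<le>1. X (n + i) = (if i = 0 then x else y)}"
    by (auto simp: le_Suc_eq)
  then show ?thesis
    using quenched_law_cylinder_from[of \<omega> 1 n "\<lambda>i. if i = 0 then x else y"] by simp
qed

text \<open>At the origin the walk after time \<open>n\<close> restarts with the quenched law
  itself. Both sides are finite measures in \<open>B\<close> that agree on cylinders, an
  intersection-stable generator.\<close>

lemma quenched_law_markov_origin:
  assumes "B \<in> sets path_space"
  shows "emeasure (quenched_law \<omega>) {X. X n = 0 \<and> (\<lambda>i. X (n + i)) \<in> B} =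
    emeasure (quenched_law \<omega>) {X. X n = 0} * emeasure (quenched_law \<omega>) B"
proof -
  interpret P: prob_space "quenched_law \<omega>" by (rule prob_space_quenched_law)
  let ?M = "quenched_law \<omega>"
  let ?S = "\<lambda>X :: nat \<Rightarrow> site. \<lambda>i. X (n + i)"
  have sM: "measurable ?M path_space = measurable path_space path_space"
    by (rule measurable_cong_sets) simp_all
  define D where "D = density ?M (indicator {X. X n = 0})"
  define N1 where "N1 = distr D path_space ?S"
  define N2 where "N2 = scale_measure (emeasure ?M {X. X n = 0}) ?M"
  have mD: "?S \<in> D \<rightarrow>\<^sub>M path_space"
    unfolding D_def using measurable_path_shift[of n] by (simp add: sM)
  have N1: "emeasure N1 A = emeasure ?M {X. X n = 0 \<and> ?S X \<in> A}" if A: "A \<in> sets path_space" for A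
  proof -
    have s: "?S -` A \<in> sets ?M"
      using measurable_sets[OF measurable_path_shift A, of n] by simp
    have "emeasure N1 A = emeasure D (?S -` A \<inter> space D)"
      unfolding N1_def by (rule emeasure_distr[OF mD A])
    also have "\<dots> = emeasure D (?S -` A)" by (simp add: D_def)
    also have "\<dots> = emeasure ?M ({X. X n = 0} \<inter> ?S -` A)"
      unfolding D_def by (rule emeasure_restricted[OF _ s]) simp
    finally show ?thesis by (simp add: Collect_conj_eq vimage_def)
  qed
  have N2: "emeasure N2 A = emeasure ?M {X. X n = 0} * emeasure ?M A" for A
    by (simp add: N2_def)
  let ?G = "insert {} {{X. \<forall>i\<le>m. X i = x i} | m x. True} :: (nat \<Rightarrow> site) set set"
  have cyl: "{X. \<forall>i\<le>k. X i = x i} \<inter> {X. \<forall>i\<le>m. X i = y i} \<in> ?G" (is "?A \<inter> ?B \<in> _")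
    for k m and x y :: "nat \<Rightarrow> site"
  proof (cases "?A \<inter> ?B = {}")
    case False
    then obtain Z where Z: "Z \<in> ?A" "Z \<in> ?B" by auto
    have "?A \<inter> ?B = {X. \<forall>i\<le>max k m. X i = Z i}" using Z by (auto simp: le_max_iff_disj)
    then show ?thesis by blast
  qed auto
  have "N1 = N2"
  proof (rule measure_eqI_generator_eq_countable[where E="?G" and \<Omega>=UNIV and A="range (\<lambda>x. {X. \<forall>i\<le>0::nat. X i = x})"])
    show "Int_stable ?G"
    proof (rule Int_stableI)
      fix a b assume a: "a \<in> ?G" and b: "b \<in> ?G"
      show "a \<inter> b \<in> ?G"
      proof (cases "a = {} \<or> b = {}")
        case False
        with a b obtain k x m y where "a = {X. \<forall>i\<le>k. X i = x i}" "b = {X. \<forall>i\<le>m. X i = y i}"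
          by blast
        then show ?thesis using cyl[of k x m y] by (simp only:)
      qed auto
    qed
    show "sets N1 = sigma_sets UNIV ?G" "sets N2 = sigma_sets UNIV ?G"
      by (simp_all add: N1_def N2_def sets_path_space_eq)
    fix A assume "A \<in> ?G"
    then consider "A = {}" | m x where "A = {X. \<forall>i\<le>m. X i = x i}" by blast
    then show "emeasure N1 A = emeasure N2 A"
    proof cases
      case 2
      have A: "A \<in> sets path_space" unfolding 2 by (rule path_cylinder_sets)
      show ?thesis
      proof (cases "x 0 = 0")
        case True
        have "{X. X n = 0 \<and> ?S X \<in> A} = {X. \<forall>i\<le>m. X (n + i) = x i}"
          unfolding 2 using True by (auto dest: spec[of _ 0])
        then show ?thesis
          unfolding N1[OF A] N2 using quenched_law_cylinder_from[of \<omega> m n x] True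
          by (simp add: emeasure_quenched_cylinder[of \<omega> m x, folded 2])
      next
        case False
        then have "{X. X n = 0 \<and> ?S X \<in> A} = {}"
          unfolding 2 by (auto dest: spec[of _ 0])
        then show ?thesis
          unfolding N1[OF A] N2 using False
          by (simp only: emeasure_quenched_cylinder[of \<omega> m x, folded 2] emeasure_empty) simp
      qed
    qed simp
  next
    show "range (\<lambda>x. {X. \<forall>i\<le>0::nat. X i = x}) \<subseteq> ?G" by blast
    fix a :: "(nat \<Rightarrow> site) set" assume "a \<in> range (\<lambda>x. {X. \<forall>i\<le>0::nat. X i = x})"
    then have "a \<in> sets path_space" by auto
    then show "emeasure N1 a \<noteq> \<infinity>" by (simp add: N1)
  qed auto
  then show ?thesis using N1[OF assms] N2 by simp
qed

text \<open>The last visits to the origin: the events \<open>X\<^sub>n = 0\<close> without later visit are disjoint and have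
  probability \<open>P(X\<^sub>n = 0)\<close> times the escape probability.\<close>

lemma quenched_recurrent:
  assumes "\<not> summable (\<lambda>n. measure (quenched_law \<omega>) {X. X n = 0})"
  shows "AE X in quenched_law \<omega>. recurrent X"
proof -
  interpret P: prob_space "quenched_law \<omega>" by (rule prob_space_quenched_law)
  let ?M = "quenched_law \<omega>"
  define B where "B = {X :: nat \<Rightarrow> site. \<forall>i. 0 < i \<longrightarrow> X i \<noteq> 0}"
  define A where "A n = {X :: nat \<Rightarrow> site. X n = 0 \<and> (\<lambda>i. X (n + i)) \<in> B}" for n
  have B: "B \<in> sets path_space"
  proof -
    have "{X \<in> space path_space. \<forall>i. 0 < i \<longrightarrow> X i \<noteq> 0} \<in> sets path_space" by measurable
    then show ?thesis by (simp add: B_def)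
  qed
  have A_sets: "A n \<in> sets ?M" for n
  proof -
    have "A n = {X. X n = 0} \<inter> ((\<lambda>X i. X (n + i)) -` B \<inter> space path_space)"
      by (auto simp: A_def)
    then show ?thesis
      using measurable_sets[OF measurable_path_shift B, of n] path_event_sets(1)[of n 0]
      by (simp add: sets.Int)
  qed
  have A_eq: "P.prob (A n) = P.prob {X. X n = 0} * P.prob B" for n
    using quenched_law_markov_origin[OF B, of \<omega> n]
    by (simp add: A_def measure_def enn2real_mult)
  have "disjoint_family A"
  proof -
    have "A m \<inter> A n = {}" if "m < n" for m n
    proof -
      have "X n \<noteq> 0" if "X \<in> A m" for X
        using that \<open>m < n\<close> by (simp add: A_def B_def) (metis add_diff_inverse_nat less_imp_not_less zero_less_diff)
      then show ?thesis by (auto simp: A_def)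
    qed
    then show ?thesis unfolding disjoint_family_on_def by (metis linorder_neqE_nat Int_commute)
  qed
  then have "summable (\<lambda>n. P.prob (A n))"
    using P.finite_measure_UNION[of A] A_sets by (auto dest: sums_summable)
  then have "summable (\<lambda>n. P.prob {X. X n = 0} * P.prob B)" by (simp only: A_eq)
  \<comment> \<open>If the escape probability were positive, dividing by it would make the return
    probabilities summable.\<close>
  then have "P.prob B = 0"
    using assms summable_mult2[of "\<lambda>n. P.prob {X. X n = 0} * P.prob B" "inverse (P.prob B)"]
    by (cases "P.prob B = 0") (simp_all add: mult.assoc)
  then have "A n \<in> null_sets ?M" for n
    using A_eq[of n] A_sets[of n] by (simp add: null_sets_def P.emeasure_eq_measure)
  then have "AE X in ?M. X \<notin> A n" for n by (rule AE_not_in)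
  then have "AE X in ?M. \<forall>n. X \<notin> A n" by (simp add: AE_all_countable)
  moreover have "AE X in ?M. X 0 = 0"
  proof -
    have "P.prob {X. X 0 = 0} = 1"
      using quenched_law_start[of \<omega> 0] by (simp add: P.emeasure_eq_measure)
    then show ?thesis using P.AE_prob_1[of "{X. X 0 = 0}"] by simp
  qed
  ultimately show ?thesis
  proof eventually_elim
    fix X :: "nat \<Rightarrow> site" assume X: "\<forall>n. X \<notin> A n" "X 0 = 0"
    show "recurrent X"
      unfolding recurrent_def
    proof
      assume fin: "finite {n. X n = 0}"
      define m where "m = Max {n. X n = 0}"
      have m: "X m = 0" "\<And>n. X n = 0 \<Longrightarrow> n \<le> m"
        using Max_in[OF fin] Max_ge[OF fin] X(2) by (auto simp: m_def)
      have "X (m + i) \<noteq> 0" if "0 < i" for i using m(2)[of "m + i"] that by auto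
      with m(1) have "X \<in> A m" by (simp add: A_def B_def)
      with X show False by simp
    qed
  qed
qed

section \<open>Stationary environments\<close>

lemma smult_simps [simp]:
  "0 \<cdot>\<^sub>s e = 0" "1 \<cdot>\<^sub>s e = e" "k \<cdot>\<^sub>s (- e) = - (k \<cdot>\<^sub>s e)"
  by (simp_all add: smult_site_def zero_prod_def prod_eq_iff)

lemma smult_add: "(j + k) \<cdot>\<^sub>s e = j \<cdot>\<^sub>s e + k \<cdot>\<^sub>s e"
  by (simp add: smult_site_def algebra_simps)

lemma smult_Suc: "Suc k \<cdot>\<^sub>s e = k \<cdot>\<^sub>s e + e"
  by (simp add: smult_site_def prod_eq_iff algebra_simps)

lemma smult_diff: "j \<le> k \<Longrightarrow> (k - j) \<cdot>\<^sub>s e = k \<cdot>\<^sub>s e - j \<cdot>\<^sub>s e"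
  using smult_add[of "k - j" j e] by simp

lemma env_shift_add: "env_shift (x + y) \<omega> = env_shift y (env_shift x \<omega>)"
  by (simp add: env_shift_def add.assoc)

lemma env_shift_0 [simp]: "env_shift 0 \<omega> = \<omega>"
  by (simp add: env_shift_def)

lemma next_dist_eq_infinity_iff: "next_dist e \<omega> = \<infinity> \<longleftrightarrow> (\<forall>k>0. \<not> \<omega> (k \<cdot>\<^sub>s e))"
proof
  assume inf: "next_dist e \<omega> = \<infinity>"
  show "\<forall>k>0. \<not> \<omega> (k \<cdot>\<^sub>s e)"
  proof (intro allI impI notI)
    fix k :: nat assume "k > 0" "\<omega> (k \<cdot>\<^sub>s e)"
    then have "next_dist e \<omega> \<le> enat k" unfolding next_dist_def by (intro INF_lower) simp
    with inf show False by simp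
  qed
next
  assume none: "\<forall>k>0. \<not> \<omega> (k \<cdot>\<^sub>s e)"
  show "next_dist e \<omega> = \<infinity>"
  proof (cases "next_dist e \<omega>")
    case (enat k)
    then show ?thesis using none unfolding next_dist_eq_enat_iff by blast
  qed
qed

text \<open>The unit edge \<open>(z, z + e)\<close> lies in an interval of length \<open>k\<close>
  between consecutive points, at offset \<open>j\<close> from its start. The strict
  \<open>j < k\<close> makes these intervals half-open, so neighboring ones share no edge.\<close>

definition covers :: "site \<Rightarrow> site \<Rightarrow> nat \<Rightarrow> env \<Rightarrow> bool" where
  "covers e z k \<omega> \<longleftrightarrow>
     (\<exists>j<k. \<omega> (z - j \<cdot>\<^sub>s e) \<and> next_dist e (env_shift (z - j \<cdot>\<^sub>s e) \<omega>) = enat k)"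

text \<open>The conductance of the unit edge \<open>(z, z + e)\<close> once each interval of length \<open>k\<close> between
  consecutive points is replaced by \<open>k\<close> resistors of conductance \<open>k\<close> in series; 0 on edges that no
  such interval covers.\<close>

definition gap :: "site \<Rightarrow> site \<Rightarrow> env \<Rightarrow> nat" where
  "gap e z \<omega> = (if \<exists>k. covers e z k \<omega> then LEAST k. covers e z k \<omega> else 0)"

lemma measurable_next_dist_shift [measurable]:
  "Measurable.pred env_space (\<lambda>\<omega>. next_dist e (env_shift v \<omega>) = enat k)"
  by (rule measurable_compose[OF measurable_env_shift measurable_next_dist])

lemma measurable_covers [measurable]: "Measurable.pred env_space (covers e z k)"
  unfolding covers_def by measurable

lemma measurable_gap [measurable]: "gap e z \<in> env_space \<rightarrow>\<^sub>M count_space UNIV"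
  unfolding gap_def by measurable

lemma covers_gap: "gap e z \<omega> > 0 \<Longrightarrow> covers e z (gap e z \<omega>) \<omega>"
  unfolding gap_def by (auto intro: LeastI split: if_splits)

section \<open>Stationarity and the probability that a long interval covers a given edge\<close>

locale stationary_env = prob_space Q for Q :: "env measure" +
  assumes sets_Q: "sets Q = sets env_space"
    and stationary: "stationary Q (env_shift e1)" "stationary Q (env_shift e2)"
begin

lemma space_Q [simp]: "space Q = UNIV"
  using sets_eq_imp_space_eq[OF sets_Q] by simp

lemma measurable_Q: "measurable Q N = measurable env_space N"
  by (rule measurable_cong_sets[OF sets_Q refl])

lemma event_Q: "Measurable.pred env_space P \<Longrightarrow> {\<omega>. P \<omega>} \<in> sets Q"
  using sets_Q by (simp add: pred_def)

lemma vimage_shift_sets: "A \<in> sets Q \<Longrightarrow> env_shift x -` A \<in> sets Q"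
  using measurable_sets[OF measurable_env_shift, of A x] by (simp add: sets_Q)

text \<open>The translations that preserve \<open>Q\<close> form a group: they compose, and shifting
  back and forth is the identity. This group contains \<open>e1\<close> and \<open>e2\<close>, hence
  everything.\<close>

lemma emeasure_shift: "A \<in> sets Q \<Longrightarrow> emeasure Q (env_shift x -` A) = emeasure Q A"
proof -
  define S where "S x \<longleftrightarrow> (\<forall>A\<in>sets Q. emeasure Q (env_shift x -` A) = emeasure Q A)" for x
  have S_add: "S (x + y)" if "S x" "S y" for x y
  proof -
    have "env_shift (x + y) -` A = env_shift x -` (env_shift y -` A)" for A
      by (auto simp: env_shift_add)
    then show ?thesis using that vimage_shift_sets by (simp add: S_def)
  qed
  have S_minus: "S (- x)" if "S x" for x
    unfolding S_def
  proof
    fix A assume A: "A \<in> sets Q"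
    have "env_shift x -` (env_shift (- x) -` A) = A"
      by (auto simp: env_shift_add[symmetric])
    then show "emeasure Q (env_shift (- x) -` A) = emeasure Q A"
      using that vimage_shift_sets[OF A, of "- x"] by (auto simp: S_def)
  qed
  have S_e: "S e" if "e \<in> {e1, e2}" for e
    unfolding S_def
  proof
    fix A assume A: "A \<in> sets Q"
    have st: "env_shift e \<in> Q \<rightarrow>\<^sub>M Q" "distr Q Q (env_shift e) = Q"
      using that stationary by (auto simp: stationary_def)
    show "emeasure Q (env_shift e -` A) = emeasure Q A"
      using emeasure_distr[OF st(1) A] st(2) by simp
  qed
  have S_int: "S (i * fst e, i * snd e)" if "S e" for e i
  proof (induction i rule: int_induct[where k=0])
    case base
    show ?case by (simp add: S_def zero_prod_def[symmetric] vimage_def)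
  next
    case (step1 i)
    show ?case using S_add[OF step1(2) that] by (simp add: plus_prod_def algebra_simps)
  next
    case (step2 i)
    show ?case using S_add[OF step2(2) S_minus[OF that]]
      by (simp add: plus_prod_def uminus_prod_def algebra_simps)
  qed
  have "S ((fst x, 0) + (0, snd x))"
    using S_add[OF S_int[OF S_e[of e1], of "fst x"] S_int[OF S_e[of e2], of "snd x"]]
    by (simp add: e1_def e2_def)
  then show "A \<in> sets Q \<Longrightarrow> emeasure Q (env_shift x -` A) = emeasure Q A" by (simp add: S_def)
qed

text \<open>Poincare recurrence: the events that \<open>k \<cdot>\<^sub>s e\<close> is the last point on its half-line are disjoint
  and equally likely.\<close>

lemma AE_next_dist_finite: "AE \<omega> in Q. \<forall>v. \<omega> v \<longrightarrow> next_dist e (env_shift v \<omega>) \<noteq> \<infinity>"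
proof -
  define A where "A = {\<omega>. \<omega> 0 \<and> (\<forall>k>0. \<not> \<omega> (k \<cdot>\<^sub>s e))}"
  have A: "A \<in> sets Q" unfolding A_def by (rule event_Q) measurable
  have "prob A = 0"
  proof -
    define B where "B k = env_shift (k \<cdot>\<^sub>s e) -` A" for k
    have B: "B k \<in> sets Q" for k unfolding B_def by (rule vimage_shift_sets[OF A])
    have "disjoint_family B"
    proof -
      have "B j \<inter> B k = {}" if "j < k" for j k
      proof -
        have "\<not> \<omega> (k \<cdot>\<^sub>s e)" if "\<omega> \<in> B j" for \<omega>
        proof -
          have "\<not> \<omega> (j \<cdot>\<^sub>s e + (k - j) \<cdot>\<^sub>s e)"
            using that \<open>j < k\<close> by (simp add: B_def A_def env_shift_def)
          then show ?thesis using \<open>j < k\<close> by (simp add: smult_add[symmetric])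
        qed
        then show ?thesis by (auto simp: B_def A_def env_shift_def)
      qed
      then show ?thesis unfolding disjoint_family_on_def by (metis linorder_neqE_nat Int_commute)
    qed
    then have "summable (\<lambda>k. prob (B k))"
      using finite_measure_UNION[of B] B by (auto dest: sums_summable)
    moreover have "prob (B k) = prob A" for k
      unfolding B_def measure_def by (simp add: emeasure_shift[OF A])
    ultimately show ?thesis by (simp add: summable_const_iff)
  qed
  then have "env_shift v -` A \<in> null_sets Q" for v
    using A emeasure_shift[OF A, of v] by (simp add: null_sets_def vimage_shift_sets emeasure_eq_measure)
  then have "AE \<omega> in Q. \<omega> \<notin> env_shift v -` A" for v by (rule AE_not_in)
  then have "AE \<omega> in Q. \<forall>v. \<omega> \<notin> env_shift v -` A" by (simp only: AE_all_countable) simp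
  then show ?thesis
    by eventually_elim (simp add: A_def next_dist_eq_infinity_iff env_shift_def)
qed

text \<open>Union bound over the \<open>k\<close> possible starting points of the interval, all
  equally likely by stationarity.\<close>

lemma emeasure_covers_le:
  "emeasure Q {\<omega>. covers e z k \<omega>} \<le> of_nat k * emeasure Q {\<omega>. \<omega> 0 \<and> next_dist e \<omega> = enat k}"
proof -
  define A where "A = {\<omega>. \<omega> 0 \<and> next_dist e \<omega> = enat k}"
  have A: "A \<in> sets Q" unfolding A_def by (rule event_Q) measurable
  have "{\<omega>. covers e z k \<omega>} = (\<Union>j<k. env_shift (z - j \<cdot>\<^sub>s e) -` A)"
    by (auto simp: covers_def A_def env_shift_def)
  also have "emeasure Q \<dots> \<le> (\<Sum>j<k. emeasure Q (env_shift (z - j \<cdot>\<^sub>s e) -` A))"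
    by (rule emeasure_subadditive_finite) (auto simp: vimage_shift_sets A)
  also have "\<dots> = of_nat k * emeasure Q A" by (simp add: emeasure_shift A)
  finally show ?thesis by (simp add: A_def)
qed

text \<open>Conditioning on a point at the origin divides by a probability of at most 1.\<close>

lemma emeasure_le_env_cond:
  assumes "A \<in> sets Q" "emeasure Q {\<omega>. \<omega> 0} > 0"
  shows "emeasure Q ({\<omega>. \<omega> 0} \<inter> A) \<le> emeasure (env_cond Q) A"
proof -
  have [measurable]: "{\<omega>. \<omega> 0} \<in> sets Q" by (rule event_Q) measurable
  have pos: "prob {\<omega>. \<omega> 0} > 0" using assms(2) by (simp add: emeasure_eq_measure)
  have "emeasure (env_cond Q) A = ennreal (prob ({\<omega>. \<omega> 0} \<inter> A) / prob {\<omega>. \<omega> 0})"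
    unfolding env_cond_def using assms(1) pos by (simp add: emeasure_eq_measure divide_ennreal)
  moreover have "prob ({\<omega>. \<omega> 0} \<inter> A) / 1 \<le> prob ({\<omega>. \<omega> 0} \<inter> A) / prob {\<omega>. \<omega> 0}"
    using pos by (intro divide_left_mono) auto
  ultimately show ?thesis by (simp add: emeasure_eq_measure)
qed

text \<open>A gap of at least \<open>N\<close> means that some interval of length
  \<open>N + j\<close> covers the edge; countable subadditivity then reproduces the series of the
  tail assumption.\<close>

lemma prob_gap_le:
  assumes bound: "tail_bound Q C" and e: "e \<in> {e1, e2}" and N: "1 \<le> N" and C: "C \<ge> 0"
    and pos: "emeasure Q {\<omega>. \<omega> 0} > 0"
  shows "prob {\<omega>. N \<le> gap e z \<omega>} \<le> C / real N"
proof -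
  have [simp]: "space (env_cond Q) = UNIV" by (simp add: env_cond_def)
  have "emeasure Q {\<omega>. N \<le> gap e z \<omega>} \<le> emeasure Q (\<Union>j. {\<omega>. covers e z (N + j) \<omega>})"
  proof (rule emeasure_mono)
    show "{\<omega>. N \<le> gap e z \<omega>} \<subseteq> (\<Union>j. {\<omega>. covers e z (N + j) \<omega>})"
    proof
      fix \<omega> assume "\<omega> \<in> {\<omega>. N \<le> gap e z \<omega>}"
      then have "covers e z (N + (gap e z \<omega> - N)) \<omega>" using covers_gap[of e z \<omega>] N by simp
      then show "\<omega> \<in> (\<Union>j. {\<omega>. covers e z (N + j) \<omega>})" by blast
    qed
    show "(\<Union>j. {\<omega>. covers e z (N + j) \<omega>}) \<in> sets Q"
      by (intro sets.countable_UN) (auto intro!: event_Q)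
  qed
  also have "\<dots> \<le> (\<Sum>j. emeasure Q {\<omega>. covers e z (N + j) \<omega>})"
    by (rule emeasure_subadditive_countably) (auto intro!: event_Q)
  also have "\<dots> \<le> (\<Sum>j. of_nat (N + j) *
      emeasure (env_cond Q) {\<omega>\<in>space (env_cond Q). next_dist e \<omega> = enat (N + j)})"
  proof (rule suminf_le)
    fix j
    have "{\<omega>. next_dist e \<omega> = enat (N + j)} \<in> sets Q" by (rule event_Q) measurable
    from emeasure_le_env_cond[OF this pos]
    have "of_nat (N + j) * emeasure Q {\<omega>. \<omega> 0 \<and> next_dist e \<omega> = enat (N + j)} \<le>
       of_nat (N + j) * emeasure (env_cond Q) {\<omega>. next_dist e \<omega> = enat (N + j)}"
      by (intro mult_left_mono) (simp_all add: Collect_conj_eq)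
    then show "emeasure Q {\<omega>. covers e z (N + j) \<omega>} \<le> of_nat (N + j) *
      emeasure (env_cond Q) {\<omega>\<in>space (env_cond Q). next_dist e \<omega> = enat (N + j)}"
      using emeasure_covers_le[of e z "N + j"] by simp
  qed auto
  also have "\<dots> \<le> ennreal (C / real N)" using bound e N by (simp only: tail_bound_def)
  finally show ?thesis using C by (simp add: emeasure_eq_measure)
qed

end

text \<open>For \<open>k \<ge> N\<close> one has \<open>N * k \<le> k^2\<close>, so \<open>N\<close>
  times the series is at most the second moment.\<close>

lemma tail_bound_of_second_moment:
  assumes sets: "sets Q = sets env_space"
    and moment: "\<And>e. e \<in> {e1, e2} \<Longrightarrow>
      (\<integral>\<^sup>+\<omega>. (ennreal_of_enat (next_dist e \<omega>))\<^sup>2 \<partial>env_cond Q) < \<infinity>"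
  shows "\<exists>C>0. tail_bound Q C"
proof -
  have st: "sets (env_cond Q) = sets env_space" using sets by (simp add: sets_env_cond)
  have [simp]: "space (env_cond Q) = UNIV" using sets_eq_imp_space_eq[OF st] by simp
  let ?m = "\<lambda>e. \<integral>\<^sup>+\<omega>. (ennreal_of_enat (next_dist e \<omega>))\<^sup>2 \<partial>env_cond Q"
  \<comment> \<open>One constant has to serve both directions; the added 1 makes it visibly
    positive.\<close>
  define C where "C = enn2real (?m e1) + enn2real (?m e2) + 1"
  have C: "?m e \<le> ennreal C" if "e \<in> {e1, e2}" for e
  proof -
    have "?m e = ennreal (enn2real (?m e))" using moment[OF that] by (simp add: less_top)
    also have "\<dots> \<le> ennreal C" using that by (intro ennreal_leI) (auto simp: C_def)
    finally show ?thesis .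
  qed
  have "tail_bound Q C"
    unfolding tail_bound_def
  proof (intro ballI allI impI)
    fix e N assume e: "e \<in> {e1, e2}" and N: "1 \<le> (N::nat)"
    let ?A = "\<lambda>j. {\<omega>\<in>space (env_cond Q). next_dist e \<omega> = enat (N + j)}"
    have A: "?A j \<in> sets (env_cond Q)" for j
      using measurable_next_dist[of e "N + j"] st by (simp add: pred_def)
    let ?S = "\<Sum>j. of_nat (N + j) * emeasure (env_cond Q) (?A j)"
    have "of_nat N * ?S = (\<Sum>j. of_nat N * (of_nat (N + j) * emeasure (env_cond Q) (?A j)))"
      by (rule ennreal_suminf_cmult[symmetric])
    also have "\<dots> = (\<Sum>j. \<integral>\<^sup>+\<omega>. of_nat N * of_nat (N + j) * indicator (?A j) \<omega> \<partial>env_cond Q)"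
      by (simp only: mult.assoc[symmetric] nn_integral_cmult_indicator[OF A])
    also have "\<dots> = (\<integral>\<^sup>+\<omega>. (\<Sum>j. of_nat N * of_nat (N + j) * indicator (?A j) \<omega>) \<partial>env_cond Q)"
      by (intro nn_integral_suminf[symmetric] borel_measurable_times_ennreal borel_measurable_indicator A) simp_all
    also have "\<dots> \<le> ?m e"
    proof (rule nn_integral_mono)
      fix \<omega>
      show "(\<Sum>j. of_nat N * of_nat (N + j) * indicator (?A j) \<omega>) \<le> (ennreal_of_enat (next_dist e \<omega>))\<^sup>2"
      proof (cases "\<exists>i. next_dist e \<omega> = enat (N + i)")
        case True
        then obtain i where i: "next_dist e \<omega> = enat (N + i)" by blast
        have "(\<Sum>j. of_nat N * of_nat (N + j) * indicator (?A j) \<omega>) =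
            (\<Sum>j\<in>{i}. of_nat N * of_nat (N + j) * indicator (?A j) \<omega> :: ennreal)"
          by (rule suminf_finite) (auto simp: i)
        also have "\<dots> \<le> of_nat (N + i) * of_nat (N + i)"
          by (auto simp: i intro!: mult_right_mono)
        also have "\<dots> = (ennreal_of_enat (next_dist e \<omega>))\<^sup>2" by (simp add: i power2_eq_square)
        finally show ?thesis .
      next
        case False
        then have "(\<Sum>j. of_nat N * of_nat (N + j) * indicator (?A j) \<omega> :: ennreal) = (\<Sum>j. 0)"
          by (intro suminf_cong) auto
        then show ?thesis by simp
      qed
    qed
    also have "\<dots> \<le> ennreal C" by (rule C[OF e])
    finally have "of_nat N * ?S \<le> ennreal C" .
    then have "(?S * of_nat N) / of_nat N \<le> ennreal C / of_nat N"
      by (intro divide_right_mono_ennreal) (simp only: mult.commute)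
    moreover have "(?S * of_nat N) / of_nat N = ?S"
      by (rule mult_divide_eq_ennreal) (use N in simp_all)
    ultimately have "?S \<le> ennreal C / of_nat N" by (simp only:)
    also have "\<dots> = ennreal (C / real N)"
      using N by (subst ennreal_of_nat_eq_real_of_nat, subst divide_ennreal) (auto simp: C_def)
    finally show "?S \<le> ennreal (C / real N)" .
  qed
  moreover have "C > 0" by (simp add: C_def add_nonneg_pos)
  ultimately show ?thesis by blast
qed

section \<open>Energy of radial functions\<close>

definition jump :: "env \<Rightarrow> site \<Rightarrow> site \<Rightarrow> site" where
  "jump \<omega> e v = v + the_enat (next_dist e (env_shift v \<omega>)) \<cdot>\<^sub>s e"

definition nrm :: "site \<Rightarrow> nat" where
  "nrm x = nat (max \<bar>fst x\<bar> \<bar>snd x\<bar>)"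

text \<open>Edges are named by their lower endpoint in direction \<open>e\<close>, and may leave or
  enter the box of radius \<open>n\<close>. Hence the asymmetric pair of positions \<open>n\<close>
  and \<open>- n - 1\<close> on the two sides.\<close>

definition sphere_edges :: "site \<Rightarrow> nat \<Rightarrow> site set" where
  "sphere_edges e n = {z. (nrm (z + e) \<le> n) \<noteq> (nrm z \<le> n)}"

lemma nrm_le_iff: "nrm x \<le> n \<longleftrightarrow> \<bar>fst x\<bar> \<le> int n \<and> \<bar>snd x\<bar> \<le> int n"
  by (auto simp: nrm_def)

lemma finite_nrm_le: "finite {x. nrm x \<le> n}"
  by (rule finite_subset[of _ "{- int n..int n} \<times> {- int n..int n}"]) (auto simp: nrm_le_iff)

lemma sphere_edges_subset:
  "sphere_edges e1 n \<subseteq> {int n, - int n - 1} \<times> {- int n..int n}"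
  "sphere_edges e2 n \<subseteq> {- int n..int n} \<times> {int n, - int n - 1}"
  by (auto simp: sphere_edges_def nrm_le_iff e1_def e2_def)

lemma finite_sphere_edges: "e \<in> {e1, e2} \<Longrightarrow> finite (sphere_edges e n)"
  using sphere_edges_subset[of n] by (auto intro: finite_subset)

lemma card_sphere_edges: "e \<in> {e1, e2} \<Longrightarrow> card (sphere_edges e n) \<le> 4 * Suc n"
proof -
  have "card ({int n, - int n - 1} \<times> {- int n..int n}) \<le> 4 * Suc n"
    "card ({- int n..int n} \<times> {int n, - int n - 1}) \<le> 4 * Suc n"
    by (simp_all add: card_cartesian_product card_insert_if)
  then show "e \<in> {e1, e2} \<Longrightarrow> card (sphere_edges e n) \<le> 4 * Suc n"
    using card_mono[OF _ sphere_edges_subset(1)[of n]] card_mono[OF _ sphere_edges_subset(2)[of n]]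
    by fastforce
qed

lemma sphere_edges_unique:
  assumes "e \<in> {e1, e2}" "z \<in> sphere_edges e n" "z \<in> sphere_edges e m"
  shows "n = m"
  using assms by (cases z) (auto simp: sphere_edges_def nrm_le_iff e1_def e2_def)

text \<open>The test functions of the Nash-Williams argument: radial, with drop \<open>a n\<close> from the sphere of
  radius \<open>n\<close> to the next one.\<close>

definition radial :: "(nat \<Rightarrow> real) \<Rightarrow> nat \<Rightarrow> site \<Rightarrow> real" where
  "radial a N x = (\<Sum>n<N. a n * of_bool (nrm x \<le> n))"

lemma radial_0: "radial a N 0 = (\<Sum>n<N. a n)"
  by (simp add: radial_def nrm_def)

lemma finite_support_radial: "finite {x\<in>V. radial a N x \<noteq> 0}"
proof (rule finite_subset[OF _ finite_nrm_le[of N]], rule subsetI, rule ccontr)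
  fix x assume "x \<in> {x\<in>V. radial a N x \<noteq> 0}" "x \<notin> {x. nrm x \<le> N}"
  moreover from this have "radial a N x = 0" unfolding radial_def by (intro sum.neutral) auto
  ultimately show False by simp
qed

text \<open>A unit edge crosses at most one sphere, so its increment has at most one nonzero term
  and squaring produces no cross terms.\<close>

lemma radial_diff_square:
  assumes "e \<in> {e1, e2}"
  shows "(radial a N (z + e) - radial a N z)\<^sup>2 = (\<Sum>n<N. (a n)\<^sup>2 * indicator (sphere_edges e n) z)"
proof -
  let ?\<sigma> = "\<lambda>n. of_bool (nrm (z + e) \<le> n) - of_bool (nrm z \<le> n) :: real"
  have diff: "radial a N (z + e) - radial a N z = (\<Sum>n<N. a n * ?\<sigma> n)"
    unfolding radial_def right_diff_distrib by (rule sum_subtractf[symmetric])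
  have \<sigma>: "(?\<sigma> n)\<^sup>2 = indicator (sphere_edges e n) z" for n
    by (auto simp: sphere_edges_def indicator_def)
  have \<sigma>0: "?\<sigma> n = 0" if "z \<notin> sphere_edges e n" for n
    using that by (auto simp: sphere_edges_def)
  show ?thesis
  proof (cases "\<exists>m<N. z \<in> sphere_edges e m")
    case True
    then obtain m where m: "m < N" "z \<in> sphere_edges e m" by blast
    have out: "z \<notin> sphere_edges e n" if "n \<noteq> m" for n
      using sphere_edges_unique[OF assms m(2)] that by blast
    have "(\<Sum>n<N. a n * ?\<sigma> n) = (\<Sum>n\<in>{m}. a n * ?\<sigma> n)"
      by (rule sum.mono_neutral_right) (use m \<sigma>0 out in auto)
    then have "(\<Sum>n<N. a n * ?\<sigma> n)\<^sup>2 = (a m)\<^sup>2 * indicator (sphere_edges e m) z"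
      by (simp only: sum.insert finite.emptyI empty_iff sum.empty add_0_right
          power_mult_distrib \<sigma> simp_thms)
    moreover have "(\<Sum>n<N. (a n)\<^sup>2 * indicator (sphere_edges e n) z) =
        (\<Sum>n\<in>{m}. (a n)\<^sup>2 * indicator (sphere_edges e n) z :: real)"
      by (rule sum.mono_neutral_right) (use m out in auto)
    ultimately show ?thesis
      by (simp only: diff sum.insert finite.emptyI empty_iff sum.empty add_0_right simp_thms)
  next
    case False
    then have "(\<Sum>n<N. a n * ?\<sigma> n) = 0" by (intro sum.neutral) (use \<sigma>0 in auto)
    moreover have "(\<Sum>n<N. (a n)\<^sup>2 * indicator (sphere_edges e n) z :: real) = 0"
      using False by (intro sum.neutral) auto
    ultimately show ?thesis by (simp add: diff)
  qed
qed

section \<open>Intervals between consecutive points of a fixed environment\<close>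

locale full_env =
  fixes \<omega> :: env
  assumes finite_dist: "e \<in> directions \<Longrightarrow> \<omega> v \<Longrightarrow> next_dist e (env_shift v \<omega>) \<noteq> \<infinity>"
begin

definition dist_to :: "site \<Rightarrow> site \<Rightarrow> nat" where
  "dist_to e v = the_enat (next_dist e (env_shift v \<omega>))"

lemma next_dist_eq: "e \<in> directions \<Longrightarrow> \<omega> v \<Longrightarrow> next_dist e (env_shift v \<omega>) = enat (dist_to e v)"
  using finite_dist[of e v] by (auto simp: dist_to_def)

lemma jump_eq: "jump \<omega> e v = v + dist_to e v \<cdot>\<^sub>s e"
  by (simp add: jump_def dist_to_def)

lemma next_dist_shift_iff:
  "next_dist e (env_shift v \<omega>) = enat k \<longleftrightarrow>
     0 < k \<and> \<omega> (v + k \<cdot>\<^sub>s e) \<and> (\<forall>j. 0 < j \<and> j < k \<longrightarrow> \<not> \<omega> (v + j \<cdot>\<^sub>s e))"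
  by (simp add: next_dist_eq_enat_iff env_shift_def)

lemma dist_to:
  assumes "e \<in> directions" "\<omega> v"
  shows "0 < dist_to e v" "\<omega> (v + dist_to e v \<cdot>\<^sub>s e)"
    "0 < j \<Longrightarrow> j < dist_to e v \<Longrightarrow> \<not> \<omega> (v + j \<cdot>\<^sub>s e)"
  using next_dist_eq[OF assms] unfolding next_dist_shift_iff by auto

lemma minus_directions: "e \<in> directions \<Longrightarrow> - e \<in> directions"
  by (auto simp: directions_def)

lemma jump_point: "e \<in> directions \<Longrightarrow> \<omega> v \<Longrightarrow> \<omega> (jump \<omega> e v)"
  using dist_to(2) by (simp add: jump_eq)

text \<open>No point lies strictly between \<open>v\<close> and \<open>jump \<omega> e v\<close>, so
  the first point met on the way back is \<open>v\<close>. Reversibility of the walk rests on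
  this.\<close>

lemma jump_minus:
  assumes e: "e \<in> directions" and v: "\<omega> v"
  shows "jump \<omega> (- e) (jump \<omega> e v) = v"
proof -
  let ?k = "dist_to e v"
  note d = dist_to[OF e v]
  have "next_dist (- e) (env_shift (jump \<omega> e v) \<omega>) = enat ?k"
    unfolding next_dist_shift_iff jump_eq
  proof (intro conjI allI impI)
    show "\<omega> (v + ?k \<cdot>\<^sub>s e + ?k \<cdot>\<^sub>s (- e))" using v by simp
    fix j assume j: "0 < j \<and> j < ?k"
    then have eq: "v + ?k \<cdot>\<^sub>s e + j \<cdot>\<^sub>s (- e) = v + (?k - j) \<cdot>\<^sub>s e"
      by (simp add: smult_diff algebra_simps)
    then show "\<not> \<omega> (v + ?k \<cdot>\<^sub>s e + j \<cdot>\<^sub>s (- e))" using d(3)[of "?k - j"] j unfolding eq by simp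
  qed (rule d(1))
  then show ?thesis by (simp add: jump_def[of \<omega> "- e"]) (simp add: jump_eq)
qed

lemma jump_bij: "e \<in> directions \<Longrightarrow> bij_betw (jump \<omega> e) (points \<omega>) (points \<omega>)"
  using jump_minus[of e] jump_minus[of "- e"] jump_point[of e] jump_point[of "- e"]
    minus_directions[of e]
  by (intro bij_betw_byWitness[where f'="jump \<omega> (- e)"]) (auto simp: points_def)

lemma neighbors_eq:
  assumes v: "\<omega> v"
  shows "neighbors \<omega> v = (\<lambda>e. jump \<omega> e v) ` directions"
proof (intro set_eqI iffI)
  fix u assume "u \<in> neighbors \<omega> v"
  then obtain e k where e: "u = v + k \<cdot>\<^sub>s e" "e \<in> directions" "next_dist e (env_shift v \<omega>) = enat k"
    unfolding neighbors_def by blast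
  then have "u = jump \<omega> e v" by (simp add: jump_def)
  from this e(2) show "u \<in> (\<lambda>e. jump \<omega> e v) ` directions" by (rule image_eqI)
next
  fix u assume "u \<in> (\<lambda>e. jump \<omega> e v) ` directions"
  then show "u \<in> neighbors \<omega> v"
    unfolding neighbors_def using next_dist_eq[OF _ v] jump_eq by blast
qed

lemma inj_on_jump: "\<omega> v \<Longrightarrow> inj_on (\<lambda>e. jump \<omega> e v) directions"
  unfolding jump_eq using dist_to(1) by (intro inj_on_smult_directions) auto

lemma neighbors_sym:
  assumes "\<omega> u" "\<omega> v" "u \<in> neighbors \<omega> v"
  shows "v \<in> neighbors \<omega> u"
proof -
  obtain e where e: "e \<in> directions" "u = jump \<omega> e v"
    using assms(3) unfolding neighbors_eq[OF assms(2)] by blast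
  have "v = jump \<omega> (- e) u" unfolding e(2) by (rule jump_minus[OF e(1) assms(2), symmetric])
  then show ?thesis
    unfolding neighbors_eq[OF assms(1)] using minus_directions[OF e(1)] by (rule image_eqI)
qed

lemma covers_dist_to:
  assumes "e \<in> directions" "\<omega> v" "i < dist_to e v"
  shows "covers e (v + i \<cdot>\<^sub>s e) (dist_to e v) \<omega>"
  unfolding covers_def using assms next_dist_eq by (intro exI[of _ i]) simp

text \<open>If \<open>i > i'\<close>, then \<open>v'\<close> would be a point strictly inside the
  interval that starts at \<open>v\<close>, which contains none; exchanging the roles gives
  \<open>i = i'\<close>.\<close>

lemma interval_unique:
  assumes e: "e \<in> directions" and v: "\<omega> v" "\<omega> v'"
    and i: "i < dist_to e v" "i' < dist_to e v'" and eq: "v + i \<cdot>\<^sub>s e = v' + i' \<cdot>\<^sub>s e"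
  shows "v = v' \<and> i = i'"
proof -
  have le: "i \<le> i'" if v: "\<omega> v" "\<omega> v'" and i: "i < dist_to e v"
    and eq: "v + i \<cdot>\<^sub>s e = v' + i' \<cdot>\<^sub>s e" for v v' i i'
  proof (rule ccontr)
    assume "\<not> i \<le> i'"
    then have "v' = v + (i - i') \<cdot>\<^sub>s e" using eq by (simp add: smult_diff algebra_simps)
    then show False using dist_to(3)[OF e v(1), of "i - i'"] v(2) i \<open>\<not> i \<le> i'\<close> by simp
  qed
  have "i = i'" using le[OF v i(1) eq] le[OF v(2,1) i(2) eq[symmetric]] by simp
  with eq show ?thesis by simp
qed

lemma gap_eq:
  assumes e: "e \<in> directions" and v: "\<omega> v" and i: "i < dist_to e v"
  shows "gap e (v + i \<cdot>\<^sub>s e) \<omega> = dist_to e v"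
proof -
  have "k = dist_to e v" if cov: "covers e (v + i \<cdot>\<^sub>s e) k \<omega>" for k
  proof -
    obtain j where j: "j < k" and w: "\<omega> (v + i \<cdot>\<^sub>s e - j \<cdot>\<^sub>s e)"
      "next_dist e (env_shift (v + i \<cdot>\<^sub>s e - j \<cdot>\<^sub>s e) \<omega>) = enat k"
      using cov unfolding covers_def by blast
    then have "dist_to e (v + i \<cdot>\<^sub>s e - j \<cdot>\<^sub>s e) = k" by (simp add: dist_to_def)
    then show ?thesis using interval_unique[OF e v w(1) i, of j] j by simp
  qed
  then show ?thesis
    unfolding gap_def using covers_dist_to[OF e v i] by (metis (mono_tags) LeastI)
qed

text \<open>Cauchy-Schwarz for the telescoping sum over the \<open>k\<close> unit edges costs a
  factor \<open>k\<close>, which by \<open>gap_eq\<close> is the conductance of each of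
  them.\<close>

lemma energy_interval_le:
  assumes e: "e \<in> directions" and v: "\<omega> v"
  shows "(h (jump \<omega> e v) - h v)\<^sup>2 \<le>
    (\<Sum>i<dist_to e v. real (gap e (v + i \<cdot>\<^sub>s e) \<omega>) * (h (v + i \<cdot>\<^sub>s e + e) - h (v + i \<cdot>\<^sub>s e))\<^sup>2)"
    (is "_ \<le> (\<Sum>i<?k. _ * ?\<delta> i ^ 2)")
proof -
  have "h (jump \<omega> e v) - h v = (\<Sum>i<?k. h (v + Suc i \<cdot>\<^sub>s e) - h (v + i \<cdot>\<^sub>s e))"
    using sum_lessThan_telescope[of "\<lambda>i. h (v + i \<cdot>\<^sub>s e)" ?k] by (simp add: jump_eq)
  also have "\<dots> = (\<Sum>i<?k. ?\<delta> i)"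
    by (simp only: smult_Suc add.assoc[symmetric])
  finally have "(h (jump \<omega> e v) - h v)\<^sup>2 = (\<Sum>i<?k. ?\<delta> i)\<^sup>2" by simp
  also have "\<dots> \<le> (\<Sum>i<?k. (?\<delta> i)\<^sup>2) * card {..<?k}" by (rule sum_squared_le_sum_of_squares)
  also have "\<dots> = (\<Sum>i<?k. real (gap e (v + i \<cdot>\<^sub>s e) \<omega>) * (?\<delta> i)\<^sup>2)"
    by (simp add: sum_distrib_left gap_eq[OF e v] mult.commute)
  finally show ?thesis .
qed

text \<open>Intervals starting at distinct points share no edge, so each unit edge is charged at
  most once. Edges that cross no sphere of radius below \<open>N\<close> contribute 0, which leaves
  a finite sum that can be sorted by spheres.\<close>

lemma energy_le:
  assumes e: "e \<in> {e1, e2}"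
  shows "(\<Sum>\<^sub>\<infinity>v\<in>points \<omega>. (radial a N (jump \<omega> e v) - radial a N v)\<^sup>2) \<le>
    (\<Sum>n<N. (a n)\<^sup>2 * (\<Sum>z\<in>sphere_edges e n. real (gap e z \<omega>)))"
proof -
  let ?h = "radial a N"
  let ?\<delta> = "\<lambda>z. ?h (z + e) - ?h z"
  let ?g = "\<lambda>z. real (gap e z \<omega>) * (?\<delta> z)\<^sup>2"
  have dir: "e \<in> directions" using e by (auto simp: directions_def)
  define F where "F = {v\<in>points \<omega>. (?h (jump \<omega> e v) - ?h v)\<^sup>2 \<noteq> 0}"
  define Z where "Z = (\<Union>n<N. sphere_edges e n)"
  have "finite F"
    by (rule finite_subset[OF _ finite_UnI[OF finite_support_radial[of "points \<omega>" a N]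
          finite_support_comp_bij[OF jump_bij[OF dir] finite_support_radial[of "points \<omega>" a N]]]])
       (auto simp: F_def)
  have Z: "finite Z" unfolding Z_def using finite_sphere_edges[OF e] by blast
  define P where "P = (SIGMA v:F. {..<dist_to e v})"
  let ?q = "\<lambda>(v, i). v + i \<cdot>\<^sub>s e"
  have "finite P" unfolding P_def using \<open>finite F\<close> by blast
  have inj: "inj_on ?q P"
  proof (rule inj_onI)
    fix p p' assume p: "p \<in> P" "p' \<in> P" and eq: "?q p = ?q p'"
    obtain v i v' i' where "p = (v, i)" "p' = (v', i')" by (cases p, cases p') blast
    then show "p = p'"
      using p eq interval_unique[OF dir, of v v' i i'] by (auto simp: P_def F_def points_def)
  qed
  have "(\<Sum>\<^sub>\<infinity>v\<in>points \<omega>. (?h (jump \<omega> e v) - ?h v)\<^sup>2) = (\<Sum>\<^sub>\<infinity>v\<in>F. (?h (jump \<omega> e v) - ?h v)\<^sup>2)"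
    by (rule infsum_cong_neutral) (auto simp: F_def)
  also have "\<dots> = (\<Sum>v\<in>F. (?h (jump \<omega> e v) - ?h v)\<^sup>2)" using \<open>finite F\<close> by simp
  also have "\<dots> \<le> (\<Sum>v\<in>F. \<Sum>i<dist_to e v. ?g (v + i \<cdot>\<^sub>s e))"
    by (rule sum_mono, rule energy_interval_le[OF dir]) (auto simp: F_def points_def)
  also have "\<dots> = (\<Sum>p\<in>P. ?g (?q p))"
    unfolding P_def using \<open>finite F\<close> by (subst sum.Sigma) (auto simp: case_prod_unfold)
  also have "\<dots> = (\<Sum>z\<in>?q ` P. ?g z)" by (simp add: sum.reindex[OF inj])
  also have "\<dots> = (\<Sum>z\<in>?q ` P \<inter> Z. ?g z)"
  proof (rule sum.mono_neutral_right)
    show "\<forall>z\<in>?q ` P - ?q ` P \<inter> Z. ?g z = 0"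
    proof
      fix z assume "z \<in> ?q ` P - ?q ` P \<inter> Z"
      then have "(?\<delta> z)\<^sup>2 = 0" unfolding radial_diff_square[OF e] by (intro sum.neutral) (auto simp: Z_def)
      then show "?g z = 0" by simp
    qed
  qed (use \<open>finite P\<close> in auto)
  also have "\<dots> \<le> (\<Sum>z\<in>Z. ?g z)" by (rule sum_mono2[OF Z]) auto
  also have "\<dots> = (\<Sum>z\<in>Z. \<Sum>n<N. (a n)\<^sup>2 * (real (gap e z \<omega>) * indicator (sphere_edges e n) z))"
    unfolding radial_diff_square[OF e] sum_distrib_left by (simp only: mult.left_commute)
  also have "\<dots> = (\<Sum>n<N. (a n)\<^sup>2 * (\<Sum>z\<in>Z. real (gap e z \<omega>) * indicator (sphere_edges e n) z))"
    by (subst sum.swap) (simp only: sum_distrib_left)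
  also have "\<dots> = (\<Sum>n<N. (a n)\<^sup>2 * (\<Sum>z\<in>sphere_edges e n. real (gap e z \<omega>)))"
  proof -
    have "(\<Sum>z\<in>Z. real (gap e z \<omega>) * indicator (sphere_edges e n) z) =
        (\<Sum>z\<in>sphere_edges e n. real (gap e z \<omega>))" if "n < N" for n
    proof -
      have "Z \<inter> sphere_edges e n = sphere_edges e n" using that by (auto simp: Z_def)
      then show ?thesis
        using sum.inter_restrict[OF Z, of "\<lambda>z. real (gap e z \<omega>)" "sphere_edges e n"]
        by (simp add: indicator_def of_bool_def if_distrib cong: if_cong)
    qed
    then show ?thesis by (intro sum.cong refl) (simp only: lessThan_iff)
  qed
  finally show ?thesis .
qed

end

section \<open>Recurrence\<close>

context full_env
begin

lemma pmf_step_eq: "\<omega> u \<Longrightarrow> pmf (step \<omega> u) y = (if y \<in> neighbors \<omega> u then 1 / 4 else 0)"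
  using finite_dist by (intro pmf_step) blast

lemma quenched_law_Suc:
  "emeasure (quenched_law \<omega>) {X. X (Suc n) = y} =
    (\<integral>\<^sup>+x. emeasure (quenched_law \<omega>) {X. X n = x} * ennreal (pmf (step \<omega> x) y) \<partial>count_space UNIV)"
proof -
  have "{X. X (Suc n) = y} = (\<Union>x. {X :: nat \<Rightarrow> site. X n = x \<and> X (Suc n) = y})" by auto
  also have "emeasure (quenched_law \<omega>) \<dots> =
      (\<integral>\<^sup>+x. emeasure (quenched_law \<omega>) {X. X n = x \<and> X (Suc n) = y} \<partial>count_space UNIV)"
    by (rule emeasure_UN_countable) (auto simp: disjoint_family_on_def)
  finally show ?thesis by (simp only: quenched_law_two_steps)
qed

lemma quenched_law_outside:
  assumes "\<omega> 0" "\<not> \<omega> x"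
  shows "emeasure (quenched_law \<omega>) {X. X n = x} = 0"
  using assms(2)
proof (induction n arbitrary: x)
  case 0
  then show ?case using assms(1) by (auto simp: quenched_law_start indicator_def)
next
  case (Suc n)
  have "emeasure (quenched_law \<omega>) {X. X n = u} * ennreal (pmf (step \<omega> u) x) = 0" for u
  proof (cases "\<omega> u")
    case True
    have "x \<notin> neighbors \<omega> u" using Suc.prems jump_point[OF _ True] by (auto simp: neighbors_eq[OF True])
    then show ?thesis using pmf_step_eq[OF True] by simp
  qed (simp add: Suc.IH)
  then show ?case unfolding quenched_law_Suc by (simp only: nn_integral_const mult_zero_left)
qed

text \<open>The predecessors of \<open>y\<close> that carry mass are points having \<open>y\<close>
  as a neighbor; by symmetry these are the neighbors of \<open>y\<close>, and each moves to
  \<open>y\<close> with probability 1/4.\<close>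

lemma quenched_law_Suc_point:
  assumes "\<omega> 0" and y: "\<omega> y"
  shows "measure (quenched_law \<omega>) {X. X (Suc n) = y} =
    (\<Sum>e\<in>directions. measure (quenched_law \<omega>) {X. X n = jump \<omega> e y}) / 4"
proof -
  interpret P: prob_space "quenched_law \<omega>" by (rule prob_space_quenched_law)
  let ?m = "\<lambda>n x. measure (quenched_law \<omega>) {X. X n = x}"
  have em: "emeasure (quenched_law \<omega>) {X. X n = x} = ennreal (?m n x)" for n x
    by (rule P.emeasure_eq_measure)
  have fin: "finite (neighbors \<omega> y)" by (simp add: neighbors_eq[OF y] directions_def)
  have zero: "emeasure (quenched_law \<omega>) {X. X n = x} * ennreal (pmf (step \<omega> x) y) = 0"
    if "x \<notin> neighbors \<omega> y" for x
    using that y pmf_step_eq[of x y] neighbors_sym[of y x] quenched_law_outside[OF assms(1), of x n]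
    by (cases "\<omega> x") auto
  have "ennreal (?m (Suc n) y) =
      (\<Sum>x\<in>neighbors \<omega> y. emeasure (quenched_law \<omega>) {X. X n = x} * ennreal (pmf (step \<omega> x) y))"
    unfolding em[symmetric] quenched_law_Suc
    by (rule nn_integral_count_space'[OF fin]) (use zero in auto)
  also have "\<dots> = (\<Sum>x\<in>neighbors \<omega> y. ennreal (?m n x * (1 / 4)))"
  proof (rule sum.cong[OF refl])
    fix x assume x: "x \<in> neighbors \<omega> y"
    then have "\<omega> x" using jump_point[OF _ y] by (auto simp: neighbors_eq[OF y])
    then have "pmf (step \<omega> x) y = 1 / 4"
      using pmf_step_eq[of x y] neighbors_sym[of x y] x y by simp
    then show "emeasure (quenched_law \<omega>) {X. X n = x} * ennreal (pmf (step \<omega> x) y) =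
        ennreal (?m n x * (1 / 4))"
      by (simp only: em) (rule ennreal_mult''[symmetric], simp)
  qed
  also have "\<dots> = ennreal (\<Sum>x\<in>neighbors \<omega> y. ?m n x * (1 / 4))" by (rule sum_ennreal) simp
  finally have "?m (Suc n) y = (\<Sum>x\<in>neighbors \<omega> y. ?m n x * (1 / 4))"
    by (subst (asm) ennreal_inj) (auto intro: sum_nonneg)
  then show ?thesis
    unfolding neighbors_eq[OF y] by (simp add: sum.reindex[OF inj_on_jump[OF y]] sum_divide_distrib)
qed

lemma AE_recurrent:
  assumes o: "\<omega> 0"
    and div: "\<not> summable (\<lambda>n. 1 / (1 + (\<Sum>(e, z)\<in>Sigma {e1, e2} (\<lambda>e. sphere_edges e n). real (gap e z \<omega>))))"
  shows "AE X in quenched_law \<omega>. recurrent X"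
proof -
  interpret P: prob_space "quenched_law \<omega>" by (rule prob_space_quenched_law)
  define f where "f n x = measure (quenched_law \<omega>) {X. X n = x}" for n x
  have dir: "{e1, e2} \<subseteq> directions" by (auto simp: directions_def)
  have sum_dir: "(\<Sum>e\<in>directions. g e) = (\<Sum>e\<in>{e1, e2}. g e + g (- e))" for g :: "site \<Rightarrow> real"
    by (simp add: directions_def e1_def e2_def)
  \<comment> \<open>Only the positive directions serve as indices; the opposite jumps are the
    inverses, and \<open>2 * card {e1, e2}\<close> gives back the four neighbors.\<close>
  interpret W: bijection_walk "points \<omega>" "{e1, e2}" "jump \<omega>" "\<lambda>e. jump \<omega> (- e)" 0 f
  proof
    show "bij_betw (jump \<omega> e) (points \<omega>) (points \<omega>)" if "e \<in> {e1, e2}" for e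
      using that dir by (intro jump_bij) blast
    show "jump \<omega> (- e) (jump \<omega> e x) = x" if "e \<in> {e1, e2}" "x \<in> points \<omega>" for e x
      using that dir by (intro jump_minus) (auto simp: points_def)
    show "f 0 x = (if x = 0 then 1 else 0)" for x
      unfolding f_def measure_def quenched_law_start by (simp add: indicator_def)
    show "f (Suc n) x = (\<Sum>e\<in>{e1, e2}. f n (jump \<omega> e x) + f n (jump \<omega> (- e) x)) / (2 * card {e1, e2})"
      if "x \<in> points \<omega>" for n x
      using quenched_law_Suc_point[OF o, of x n] that sum_dir[of "\<lambda>e. f n (jump \<omega> e x)"]
      by (simp add: f_def points_def e1_def e2_def)
  qed (use o in \<open>auto simp: points_def\<close>)
  define c where "c n = (\<Sum>e\<in>{e1, e2}. \<Sum>z\<in>sphere_edges e n. real (gap e z \<omega>))" for n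
  have c_nonneg: "c n \<ge> 0" for n unfolding c_def by (intro sum_nonneg) simp
  have c_eq: "(\<Sum>(e, z)\<in>Sigma {e1, e2} (\<lambda>e. sphere_edges e n). real (gap e z \<omega>)) = c n" for n
    unfolding c_def using finite_sphere_edges by (subst sum.Sigma) auto
  \<comment> \<open>\<open>c n\<close> is the conductance across sphere \<open>n\<close>, and the 1
    excludes division by 0. Drops \<open>w n / S\<close> inversely proportional to
    \<open>1 + c n\<close> give energy at most the sum of \<open>w n / S^2\<close>, that is
    \<open>1 / S\<close>, because \<open>w n * c n \<le> 1\<close>.\<close>
  define w where "w n = 1 / (1 + c n)" for n
  have w_pos: "w n > 0" for n using c_nonneg[of n] by (simp add: w_def add_pos_nonneg)
  have "\<not> summable w" using div unfolding c_eq w_def .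
  have "\<not> summable (\<lambda>n. f n 0)"
  proof (rule W.green_function_diverges)
    fix \<epsilon> :: real assume \<epsilon>: "\<epsilon> > 0"
    obtain N where N: "(\<Sum>n<N. w n) > 1 / \<epsilon>"
    proof (rule ccontr)
      assume "\<not> thesis"
      then have "(\<Sum>n<N. w n) \<le> 1 / \<epsilon>" for N using that by (meson not_le)
      then have "summable w" using w_pos by (intro summableI_nonneg_bounded) (auto simp: less_imp_le)
      with \<open>\<not> summable w\<close> show False by simp
    qed
    define S where "S = (\<Sum>n<N. w n)"
    have S: "S > 0" "1 / S \<le> \<epsilon>"
    proof -
      show "S > 0" unfolding S_def by (rule less_trans[OF _ N]) (use \<epsilon> in simp)
      then show "1 / S \<le> \<epsilon>" using N \<epsilon> by (simp add: S_def field_simps)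
    qed
    define a where "a n = w n / S" for n
    have "W.form (radial a N) (radial a N) =
        (\<Sum>e\<in>{e1, e2}. \<Sum>\<^sub>\<infinity>v\<in>points \<omega>. (radial a N (jump \<omega> e v) - radial a N v)\<^sup>2)"
      by (simp add: W.form_def power2_eq_square)
    also have "\<dots> \<le> (\<Sum>e\<in>{e1, e2}. \<Sum>n<N. (a n)\<^sup>2 * (\<Sum>z\<in>sphere_edges e n. real (gap e z \<omega>)))"
      by (intro sum_mono energy_le)
    also have "\<dots> = (\<Sum>n<N. (a n)\<^sup>2 * c n)"
      by (subst sum.swap) (simp only: c_def sum_distrib_left)
    also have "\<dots> \<le> (\<Sum>n<N. a n / S)"
    proof (rule sum_mono)
      fix n
      have "w n * c n \<le> 1" using c_nonneg[of n] by (simp add: w_def)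
      then have "a n * (w n * c n) / S \<le> a n * 1 / S"
        using w_pos[of n] S(1) by (intro divide_right_mono mult_left_mono) (auto simp: a_def)
      then show "(a n)\<^sup>2 * c n \<le> a n / S" by (simp add: a_def power2_eq_square)
    qed
    also have "\<dots> = (\<Sum>n<N. w n) / S / S" by (simp add: a_def sum_divide_distrib)
    also have "\<dots> = 1 / S" using S(1) by (simp add: S_def[symmetric])
    also have "\<dots> \<le> \<epsilon>" by (rule S(2))
    finally have "W.form (radial a N) (radial a N) \<le> \<epsilon>" .
    moreover have "radial a N 0 = 1"
      using S(1) by (simp add: radial_0 a_def sum_divide_distrib[symmetric] S_def[symmetric])
    ultimately show "\<exists>h. W.fs h \<and> h 0 = 1 \<and> W.form h h \<le> \<epsilon>"
      using finite_support_radial by blast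
  qed
  then show ?thesis unfolding f_def by (rule quenched_recurrent)
qed

end

section \<open>From almost every environment to the annealed law\<close>

lemma recurrent_sets: "{X. recurrent X} \<in> sets path_space"
proof -
  have "{X \<in> space path_space. \<forall>m. \<exists>n>m. X n = 0} \<in> sets path_space" by measurable
  then show ?thesis by (simp add: recurrent_def infinite_nat_iff_unbounded)
qed

lemma (in stationary_env) AE_annealed_recurrent:
  assumes bound: "tail_bound Q C" "C > 0" and pos: "emeasure Q {\<omega>. \<omega> 0} > 0"
  shows "AE X in annealed_law Q. recurrent X"
proof -
  let ?E = "\<lambda>n. Sigma {e1, e2} (\<lambda>e. sphere_edges e n)"
  have "AE \<omega> in Q. \<not> summable (\<lambda>n. 1 / (1 + (\<Sum>i\<in>?E n. real (case i of (e, z) \<Rightarrow> gap e z \<omega>))))"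
  \<comment> \<open>The 8 comes from two directions with at most \<open>4 * Suc n\<close> crossing
    edges each. Both directions are pooled into one family indexed by pairs
    \<open>(e, z)\<close>.\<close>
  proof (rule AE_not_summable_inverse_Cauchy_tails[where a=8 and C=C])
    show "(\<lambda>\<omega>. case i of (e, z) \<Rightarrow> gap e z \<omega>) \<in> Q \<rightarrow>\<^sub>M count_space UNIV" for i
      unfolding measurable_Q by (cases i) simp
    show "finite (?E n)" for n using finite_sphere_edges by (intro finite_SigmaI) auto
    show "card (?E n) \<le> 8 * Suc n" for n
    proof -
      have "card (?E n) = (\<Sum>e\<in>{e1, e2}. card (sphere_edges e n))"
        using finite_sphere_edges by (intro card_SigmaI) auto
      also have "\<dots> \<le> (\<Sum>e\<in>{e1, e2}. 4 * Suc n)" by (intro sum_mono card_sphere_edges)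
      finally show ?thesis by (simp add: e1_def e2_def)
    qed
    show "prob {\<omega>\<in>space Q. j \<le> (case i of (e, z) \<Rightarrow> gap e z \<omega>)} \<le> C / real j"
      if "i \<in> ?E n" "1 \<le> j" for i j n
      using that prob_gap_le[OF bound(1) _ that(2) _ pos] bound(2) by (auto simp: less_imp_le)
  qed (use bound in simp)
  moreover have "AE \<omega> in Q. \<forall>e\<in>directions. \<forall>v. \<omega> v \<longrightarrow> next_dist e (env_shift v \<omega>) \<noteq> \<infinity>"
    by (intro AE_ball_countable[THEN iffD2] ballI AE_next_dist_finite) (simp add: directions_def)
  ultimately have "AE \<omega> in Q. \<omega> 0 \<longrightarrow> (AE X in quenched_law \<omega>. recurrent X)"
  proof eventually_elim
    case (elim \<omega>)
    then interpret full_env \<omega> by unfold_locales blast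
    show ?case using AE_recurrent elim(1) by (simp add: case_prod_unfold)
  qed
  \<comment> \<open>Everything so far holds for almost every \<open>\<omega>\<close> under
    \<open>Q\<close>; conditioning on a point at the origin supplies the premise
    \<open>\<omega> 0\<close>.\<close>
  then have "AE \<omega> in env_cond Q. AE X in quenched_law \<omega>. recurrent X"
    unfolding env_cond_def using pos by (intro AE_uniform_measureI) (auto intro!: event_Q)
  moreover have st: "sets (env_cond Q) = sets env_space" using sets_Q by (simp add: sets_env_cond)
  ultimately show ?thesis
    unfolding annealed_law_def using recurrent_sets
    by (subst AE_bind[where B=path_space])
       (simp_all add: measurable_cong_sets[OF st refl] pred_def)
qed

theorem theorem1p11:
  fixes Q :: "env measure"
  assumes "prob_space Q" and "sets Q = sets env_space"
    and "\<forall>e\<in>{e1, e2}. stationary Q (env_shift e) \<and> ergodic Q (env_shift e)"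
    and "measure Q {\<omega>\<in>space Q. points \<omega> = {}} < 1"
  shows "((\<exists>C>0. tail_bound Q C) \<longrightarrow> (AE X in annealed_law Q. recurrent X)) \<and>
    ((\<forall>e\<in>{e1, e2}. (\<integral>\<^sup>+\<omega>. (ennreal_of_enat (next_dist e \<omega>))\<^sup>2 \<partial>env_cond Q) < \<infinity>) \<longrightarrow>
       (\<exists>C>0. tail_bound Q C))"
proof -
  interpret stationary_env Q
    using assms by (intro stationary_env.intro stationary_env_axioms.intro) auto
  have "emeasure Q {\<omega>. \<omega> 0} > 0"
    using emeasure_origin_pos[OF assms(1,2) stationary assms(4)] by simp
  then show ?thesis
    using AE_annealed_recurrent tail_bound_of_second_moment[OF assms(2)] by blast
qed

end
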